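(* If $\rho(P_{\mathrm{RC}})<1$, then $\rho(P_{\mathrm{DG}})<1$, where $P_{\mathrm{RC}}$ is the random-scan conditional Metropolis-Hastings kernel (with any proposal density $q$ and any selection probability $r\in(0,1)$) and $P_{\mathrm{DG}}$ is the deterministic-scan Gibbs kernel.
   Context: Setting. $(\mathsf{X}\times\mathsf{Y},\mathcal{F}_X\times\mathcal{F}_Y)$ is a product measurable space with a joint probability distribution $\Pi(dx,dy)$; $\Pi_X,\Pi_Y$ are its marginals and $\Pi_{X|Y}(dx|y)$, $\Pi_{Y|X}(dy|x)$ its full conditional distributions (regular conditional probabilities), which admit densities $\pi_{X|Y}(\cdot|y)$ and $\pi_{Y|X}(\cdot|x)$ with respect to $\sigma$-finite reference measures on $\mathsf{X}$ and $\mathsf{Y}$, written $dx$ and $dy$. Standing assumption: there exist disjoint $A_1,A_2\in\mathcal{F}_X$ with $\Pi_X(A_1),\Pi_X(A_2)>0$ and disjoint $B_1,B_2\in\mathcal{F}_Y$ with $\Pi_Y(B_1),\Pi_Y(B_2)>0$. For $(x,y)\in\mathsf{X}\times\mathsf{Y}$, $q(\cdot|x,y)$ is a proposal probability density on $\mathsf{X}$ (jointly measurable). The Metropolis-Hastings kernel is \[P_{\mathrm{MH}}(dx'|x,y)=q(x'|x,y)a(x';x,y)\,dx'+\Big(1-\int q(z|x,y)a(z;x,y)\,dz\Big)\delta_x(dx'),\] \[a(z;x,y)=\min\Big\{1,\frac{\pi_{X|Y}(z|y)q(x|z,y)}{\pi_{X|Y}(x|y)q(z|x,y)}\Big\}\quad(\text{equal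 to }1\text{ if the denominator is }0).\] For each $y$ it is reversible with respect to $\Pi_{X|Y}(\cdot|y)$. Kernels on $\mathsf{X}\times\mathsf{Y}$, both with invariant distribution $\Pi$ ($\delta$ denotes point masses): \[P_{\mathrm{DG}}((x,y),(dx',dy'))=\Pi_{X|Y}(dx'|y')\Pi_{Y|X}(dy'|x),\] \[P_{\mathrm{RC}}((x,y),(dx',dy'))=r\,P_{\mathrm{MH}}(dx'|x,y)\delta_y(dy')+(1-r)\Pi_{Y|X}(dy'|x)\delta_x(dx').\] $L^2$ convergence rate. Let $P$ be a Markov transition kernel with invariant probability measure $\omega$. $L^2(\omega)$ is the real Hilbert space of square-integrable real functions, and $L_0^2(\omega)=\{f\in L^2(\omega):\int f\,d\omega=0\}$. For probability measures $\mu,\nu$, $\|\mu-\nu\|_\omega=\sup\{|\int f\,d\mu-\int f\,d\nu|: f\in L_0^2(\omega),\|f\|_\omega=1\}$. $L_*^2(\omega)$ is the set of probability measures $\mu$ with $d\mu/d\omega\in L^2(\omega)$. $(\mu P^n)(A)=\int \mu(dz)P^n(z,A)$, where $P^n$ is the $n$-step kernel. The $L^2$ convergence rate $\rho(P)$ is the infimum of $\rho\in[0,1]$ such that for each $\mu\in L_*^2(\omega)$ there is $C_\mu<\infty$ with $\|\mu P^n-\omega\|_\omega<C_\mu\rho^n$ for every positive integer $n$. *)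

theory Defs
  imports "HOL-Probability.Probability"
begin

section \<open>The \<open>L\<^sup>2\<close> convergence rate of a Markov kernel\<close>

text \<open>
  Elements of \<open>L\<^sup>2(\<omega>)\<close> are represented by functions rather than by classes modulo
  \<open>\<omega>\<close>-null sets; this is harmless because, \<open>\<omega>\<close> being invariant,
  every \<open>\<mu>P\<^sup>n\<close> with \<open>\<mu> \<in> L2_star \<omega>\<close> is absolutely continuous with respect to \<open>\<omega>\<close>.
\<close>

definition L2_fun :: "'a measure \<Rightarrow> ('a \<Rightarrow> real) set" where
  "L2_fun \<omega> = {f \<in> borel_measurable \<omega>. integrable \<omega> (\<lambda>z. (f z)\<^sup>2)}"

definition L2_fun0 :: "'a measure \<Rightarrow> ('a \<Rightarrow> real) set" where
  "L2_fun0 \<omega> = {f \<in> L2_fun \<omega>. (\<integral>z. f z \<partial>\<omega>) = 0}"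

definition L2_fun_norm :: "'a measure \<Rightarrow> ('a \<Rightarrow> real) \<Rightarrow> real" where
  "L2_fun_norm \<omega> f = sqrt (\<integral>z. (f z)\<^sup>2 \<partial>\<omega>)"

text \<open>The supremum is taken in \<^typ>\<open>ennreal\<close>, so that it is meaningful even when infinite.\<close>

definition L2_dist :: "'a measure \<Rightarrow> 'a measure \<Rightarrow> 'a measure \<Rightarrow> ennreal" where
  "L2_dist \<omega> \<mu> \<nu> =
     (SUP f \<in> {f \<in> L2_fun0 \<omega>. L2_fun_norm \<omega> f = 1}.
        ennreal \<bar>(\<integral>z. f z \<partial>\<mu>) - (\<integral>z. f z \<partial>\<nu>)\<bar>)"

definition L2_star :: "'a measure \<Rightarrow> 'a measure set" where
  "L2_star \<omega> = {\<mu>. prob_space \<mu> \<and> sets \<mu> = sets \<omega> \<and> absolutely_continuous \<omega> \<mu> \<and>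
                    (\<integral>\<^sup>+ z. (RN_deriv \<omega> \<mu> z)\<^sup>2 \<partial>\<omega>) < \<infinity>}"

primrec kernel_pow :: "'a measure \<Rightarrow> ('a \<Rightarrow> 'a measure) \<Rightarrow> nat \<Rightarrow> 'a \<Rightarrow> 'a measure" where
  "kernel_pow M P 0 = return M"
| "kernel_pow M P (Suc n) = (\<lambda>z. P z \<bind> kernel_pow M P n)"

definition L2_rate :: "'a measure \<Rightarrow> ('a \<Rightarrow> 'a measure) \<Rightarrow> real" where
  "L2_rate \<omega> P =
     Inf {\<rho> \<in> {0..1}. \<forall>\<mu> \<in> L2_star \<omega>. \<exists>C::real. \<forall>n>0.
            L2_dist \<omega> (\<mu> \<bind> kernel_pow \<omega> P n) \<omega> < ennreal (C * \<rho> ^ n)}"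


section \<open>Conditional densities\<close>

text \<open>
  A function \<open>p z c = p(z|c)\<close> that, for every \<open>c\<close>, is a probability density on \<open>M\<close> with
  respect to \<open>M\<close> itself.  The measures \<open>MX\<close> and \<open>MY\<close> below thus carry both the
  \<open>\<sigma>\<close>-algebras and the reference measures \<open>dx\<close> and \<open>dy\<close>.
\<close>

definition conditional_density :: "'a measure \<Rightarrow> 'c measure \<Rightarrow> ('a \<Rightarrow> 'c \<Rightarrow> real) \<Rightarrow> bool" where
  "conditional_density M N p \<longleftrightarrow>
     (\<lambda>(z, c). p z c) \<in> borel_measurable (M \<Otimes>\<^sub>M N) \<and>
     (\<forall>c \<in> space N. (\<forall>z \<in> space M. 0 \<le> p z c) \<and> (\<integral>\<^sup>+ z. ennreal (p z c) \<partial>M) = 1)"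

definition conditional_dist :: "'a measure \<Rightarrow> ('a \<Rightarrow> 'c \<Rightarrow> real) \<Rightarrow> 'c \<Rightarrow> 'a measure" where
  "conditional_dist M p c = density M (\<lambda>z. ennreal (p z c))"

definition marginal_X :: "'x measure \<Rightarrow> ('x \<times> 'y) measure \<Rightarrow> 'x measure" where
  "marginal_X MX PJ = distr PJ MX fst"

definition marginal_Y :: "'y measure \<Rightarrow> ('x \<times> 'y) measure \<Rightarrow> 'y measure" where
  "marginal_Y MY PJ = distr PJ MY snd"

definition is_conditional_X_given_Y ::
    "'x measure \<Rightarrow> 'y measure \<Rightarrow> ('x \<times> 'y) measure \<Rightarrow> ('y \<Rightarrow> 'x measure) \<Rightarrow> bool" where
  "is_conditional_X_given_Y MX MY PJ K \<longleftrightarrow>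
     K \<in> MY \<rightarrow>\<^sub>M prob_algebra MX \<and>
     (\<forall>A \<in> sets MX. \<forall>B \<in> sets MY.
        emeasure PJ (A \<times> B) = (\<integral>\<^sup>+ y \<in> B. emeasure (K y) A \<partial>marginal_Y MY PJ))"

definition is_conditional_Y_given_X ::
    "'x measure \<Rightarrow> 'y measure \<Rightarrow> ('x \<times> 'y) measure \<Rightarrow> ('x \<Rightarrow> 'y measure) \<Rightarrow> bool" where
  "is_conditional_Y_given_X MX MY PJ K \<longleftrightarrow>
     K \<in> MX \<rightarrow>\<^sub>M prob_algebra MY \<and>
     (\<forall>A \<in> sets MX. \<forall>B \<in> sets MY.
        emeasure PJ (A \<times> B) = (\<integral>\<^sup>+ x \<in> A. emeasure (K x) B \<partial>marginal_X MX PJ))"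


section \<open>The kernels\<close>

text \<open>
  Conventions: \<open>PJ\<close> is the joint distribution, \<open>dXY x y\<close> the density of \<open>x\<close> given
  \<open>y\<close>, \<open>dYX y x\<close> the density of \<open>y\<close> given \<open>x\<close>, and \<open>q z (x, y)\<close> the density of
  proposing \<open>z\<close> from \<open>(x, y)\<close>.
\<close>

definition MH_accept ::
    "('x \<Rightarrow> 'y \<Rightarrow> real) \<Rightarrow> ('x \<Rightarrow> 'x \<times> 'y \<Rightarrow> real) \<Rightarrow> 'x \<Rightarrow> 'x \<times> 'y \<Rightarrow> real" where
  "MH_accept dXY q z = (\<lambda>(x, y).
     if dXY x y * q z (x, y) = 0 then 1
     else min 1 ((dXY z y * q x (z, y)) / (dXY x y * q z (x, y))))"

definition P_MH ::
    "'x measure \<Rightarrow> ('x \<Rightarrow> 'y \<Rightarrow> real) \<Rightarrow> ('x \<Rightarrow> 'x \<times> 'y \<Rightarrow> real) \<Rightarrow> 'x \<times> 'y \<Rightarrow> 'x measure" where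
  "P_MH MX dXY q = (\<lambda>(x, y). measure_of (space MX) (sets MX) (\<lambda>A.
     (\<integral>\<^sup>+ z \<in> A. ennreal (q z (x, y) * MH_accept dXY q z (x, y)) \<partial>MX) +
     (1 - (\<integral>\<^sup>+ z. ennreal (q z (x, y) * MH_accept dXY q z (x, y)) \<partial>MX)) * indicator A x))"

definition P_DG ::
    "'x measure \<Rightarrow> 'y measure \<Rightarrow> ('x \<Rightarrow> 'y \<Rightarrow> real) \<Rightarrow> ('y \<Rightarrow> 'x \<Rightarrow> real) \<Rightarrow>
     'x \<times> 'y \<Rightarrow> ('x \<times> 'y) measure" where
  "P_DG MX MY dXY dYX = (\<lambda>(x, y).
     conditional_dist MY dYX x \<bind> (\<lambda>y'. conditional_dist MX dXY y' \<Otimes>\<^sub>M return MY y'))"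

definition P_RC ::
    "'x measure \<Rightarrow> 'y measure \<Rightarrow> ('x \<Rightarrow> 'y \<Rightarrow> real) \<Rightarrow> ('y \<Rightarrow> 'x \<Rightarrow> real) \<Rightarrow>
     ('x \<Rightarrow> 'x \<times> 'y \<Rightarrow> real) \<Rightarrow> real \<Rightarrow> 'x \<times> 'y \<Rightarrow> ('x \<times> 'y) measure" where
  "P_RC MX MY dXY dYX q r = (\<lambda>(x, y).
     measure_of (space (MX \<Otimes>\<^sub>M MY)) (sets (MX \<Otimes>\<^sub>M MY)) (\<lambda>E.
       ennreal r * emeasure (P_MH MX dXY q (x, y) \<Otimes>\<^sub>M return MY y) E +
       ennreal (1 - r) * emeasure (return MX x \<Otimes>\<^sub>M conditional_dist MY dYX x) E))"

end

theory Submission imports Defs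
begin

text \<open>
  Write \<open>G\<^sub>Y\<close> and \<open>G\<^sub>X\<close> for the Gibbs updates of \<open>y\<close> given \<open>x\<close> and of \<open>x\<close> given \<open>y\<close>, and \<open>M\<close> for
  the Metropolis-Hastings update of \<open>x\<close>, all regarded as operators \<open>f \<mapsto> (z \<mapsto> \<integral> f dK(z, \<cdot>))\<close>.
  On \<open>L\<^sup>2(\<Pi>)\<close> these are self-adjoint contractions; \<open>G\<^sub>Y\<close> and \<open>G\<^sub>X\<close> are the orthogonal projections
  onto the functions of \<open>x\<close> and onto the functions of \<open>y\<close>.  Moreover
  \<open>P\<^sub>D\<^sub>G = G\<^sub>Y G\<^sub>X\<close> and \<open>P\<^sub>R\<^sub>C = r M + (1 - r) G\<^sub>Y\<close>.  The theorem holds because a spectral gap of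
  \<open>P\<^sub>R\<^sub>C\<close> keeps the two subspaces at a positive angle, and that angle governs \<open>P\<^sub>D\<^sub>G\<close>.

  A geometric rate \<open>\<rho>\<close> of a reversible kernel \<open>K\<close> bounds its quadratic form:
  \<open>\<langle>f, K f\<rangle> \<le> \<rho> \<parallel>f\<parallel>\<^sup>2\<close> for \<open>f\<close> of mean zero (\<open>geometric_rate_imp_spectral_bound\<close>).  No spectral
  theorem enters: \<open>n \<mapsto> \<parallel>K\<^sup>n f\<parallel>\<^sup>2\<close> is log-convex, so its first ratio is at most its
  asymptotic rate of decay (\<open>ratio_le_of_log_convex\<close>).

  The update \<open>M\<close> fixes every function of \<open>y\<close>, so the form \<open>\<langle>f, f - M f\<rangle>\<close> depends on
  \<open>f - G\<^sub>X f\<close> only and is at most \<open>2 \<parallel>f - G\<^sub>X f\<parallel>\<^sup>2\<close>, whatever the proposal.  Let \<open>f\<close> be a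
  function of \<open>x\<close> with mean zero.  Then \<open>G\<^sub>Y f = f\<close>, and the gap of \<open>P\<^sub>R\<^sub>C\<close> gives
  \<open>(1 - \<rho>) \<parallel>f\<parallel>\<^sup>2 \<le> 2 r (\<parallel>f\<parallel>\<^sup>2 - \<parallel>G\<^sub>X f\<parallel>\<^sup>2)\<close>: the projection \<open>G\<^sub>X\<close> contracts the functions of \<open>x\<close>
  by a factor below \<open>1\<close> (\<open>alternating_contraction\<close>).  Every iterate of \<open>P\<^sub>D\<^sub>G\<close> is a function of
  \<open>x\<close>, so each step after the first contracts by that factor (\<open>alternating_rate_less_one\<close>).

  All operators act on bounded measurable functions, whose integrals against any probability
  kernel exist at every point, so that no exceptional null sets have to be carried along.
  Nothing is lost.  If \<open>f\<close> has mean zero and \<open>\<bar>f\<bar> \<le> b\<close>, then \<open>1 + f / b\<close> is the density of a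
  starting distribution in \<open>L2_star\<close>, through which the rate of \<open>P\<^sub>R\<^sub>C\<close> speaks about \<open>f\<close>; and
  bounded functions suffice to estimate \<open>L2_dist\<close>, by truncation (\<open>L2_dist_le_boundedI\<close>).
\<close>

section \<open>Bounded measurable functions\<close>

definition bdd_fun :: "'a measure \<Rightarrow> ('a \<Rightarrow> real) set" where
  "bdd_fun M = {f \<in> borel_measurable M. \<exists>b. \<forall>z\<in>space M. \<bar>f z\<bar> \<le> b}"

lemma bdd_fun_cong: "sets M = sets N \<Longrightarrow> bdd_fun M = bdd_fun N"
  unfolding bdd_fun_def using sets_eq_imp_space_eq[of M N] by (simp cong: measurable_cong_sets)

lemma bdd_funI: "f \<in> borel_measurable M \<Longrightarrow> (\<And>z. z \<in> space M \<Longrightarrow> \<bar>f z\<bar> \<le> b) \<Longrightarrow> f \<in> bdd_fun M"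
  unfolding bdd_fun_def by blast

lemma bdd_fun_measurable [measurable_dest]: "f \<in> bdd_fun M \<Longrightarrow> f \<in> borel_measurable M"
  unfolding bdd_fun_def by blast

lemma bdd_funE:
  assumes "f \<in> bdd_fun M"
  obtains b where "0 < b" "\<And>z. z \<in> space M \<Longrightarrow> \<bar>f z\<bar> \<le> b"
proof -
  obtain b where b: "\<forall>z\<in>space M. \<bar>f z\<bar> \<le> b"
    using assms unfolding bdd_fun_def by blast
  show thesis
  proof (rule that)
    show "0 < \<bar>b\<bar> + 1" by simp
    show "\<bar>f z\<bar> \<le> \<bar>b\<bar> + 1" if "z \<in> space M" for z
      using b that by (smt (verit))
  qed
qed

lemma bdd_fun_const: "(\<lambda>_. c) \<in> bdd_fun M"
  by (rule bdd_funI[where b="\<bar>c\<bar>"]) auto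

lemma bdd_fun_add:
  assumes "f \<in> bdd_fun M" "g \<in> bdd_fun M" shows "(\<lambda>z. f z + g z) \<in> bdd_fun M"
proof -
  note [measurable] = assms[THEN bdd_fun_measurable]
  obtain a where a: "\<And>z. z \<in> space M \<Longrightarrow> \<bar>f z\<bar> \<le> a"
    using assms(1) by (rule bdd_funE) blast
  obtain b where b: "\<And>z. z \<in> space M \<Longrightarrow> \<bar>g z\<bar> \<le> b"
    using assms(2) by (rule bdd_funE) blast
  show ?thesis
  proof (rule bdd_funI[where b="a+b"])
    fix z assume "z \<in> space M"
    then show "\<bar>f z + g z\<bar> \<le> a + b" using a[of z] b[of z] by linarith
  qed measurable
qed

lemma bdd_fun_mult:
  assumes "f \<in> bdd_fun M" "g \<in> bdd_fun M" shows "(\<lambda>z. f z * g z) \<in> bdd_fun M"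
proof -
  note [measurable] = assms[THEN bdd_fun_measurable]
  obtain a where a: "0 < a" "\<And>z. z \<in> space M \<Longrightarrow> \<bar>f z\<bar> \<le> a"
    using assms(1) by (rule bdd_funE) blast
  obtain b where b: "0 < b" "\<And>z. z \<in> space M \<Longrightarrow> \<bar>g z\<bar> \<le> b"
    using assms(2) by (rule bdd_funE) blast
  show ?thesis
  proof (rule bdd_funI[where b="a*b"])
    fix z assume "z \<in> space M"
    then show "\<bar>f z * g z\<bar> \<le> a * b"
      unfolding abs_mult using a b by (intro mult_mono) auto
  qed measurable
qed

lemma bdd_fun_diff:
  assumes "f \<in> bdd_fun M" "g \<in> bdd_fun M" shows "(\<lambda>z. f z - g z) \<in> bdd_fun M"
  using bdd_fun_add[OF assms(1) bdd_fun_mult[OF bdd_fun_const[of "-1"] assms(2)]] by simp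

lemmas bdd_fun_closed = bdd_fun_const bdd_fun_add bdd_fun_mult bdd_fun_diff

lemma bdd_fun_power2: "f \<in> bdd_fun M \<Longrightarrow> (\<lambda>z. (f z)\<^sup>2) \<in> bdd_fun M"
  unfolding power2_eq_square by (rule bdd_fun_mult)

lemma bdd_fun_integrable:
  assumes "finite_measure N" "sets N = sets M" "f \<in> bdd_fun M"
  shows "integrable N f"
proof -
  interpret finite_measure N by fact
  have f: "f \<in> bdd_fun N" using assms bdd_fun_cong by blast
  obtain b where "\<And>z. z \<in> space N \<Longrightarrow> \<bar>f z\<bar> \<le> b" by (rule bdd_funE[OF f]) blast
  then show ?thesis
    by (intro integrable_const_bound[where B=b] bdd_fun_measurable[OF f]) auto
qed

section \<open>Square-integrable functions\<close>

lemma quadratic_nonneg_discriminant: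
  fixes a b c :: real
  assumes "\<And>t. 0 \<le> a - 2 * t * b + t\<^sup>2 * c" "0 \<le> c"
  shows "b\<^sup>2 \<le> a * c"
proof (cases "c = 0")
  case True
  have "b = 0"
  proof (rule ccontr)
    assume "b \<noteq> 0"
    then show False using assms(1)[of "(a+1)/(2*b)"] True by simp
  qed
  then show ?thesis using True by simp
next
  case False
  with assms(2) have c: "0 < c" by simp
  have "a - 2 * (b / c) * b + (b / c)\<^sup>2 * c = a - b\<^sup>2 / c"
    using c by (simp add: power2_eq_square)
  with assms(1)[of "b / c"] have "b\<^sup>2 / c \<le> a" by simp
  then show ?thesis using c by (simp add: pos_divide_le_eq)
qed

lemma L2_fun_norm_nonneg: "0 \<le> L2_fun_norm \<omega> f"
  unfolding L2_fun_norm_def by simp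

lemma L2_fun_norm_power2: "(L2_fun_norm \<omega> f)\<^sup>2 = (\<integral>z. (f z)\<^sup>2 \<partial>\<omega>)"
  unfolding L2_fun_norm_def by simp

lemma L2_fun_prod_integrable:
  assumes "f \<in> L2_fun \<omega>" "g \<in> L2_fun \<omega>"
  shows "integrable \<omega> (\<lambda>z. f z * g z)"
proof (rule Bochner_Integration.integrable_bound[of \<omega> "\<lambda>z. (f z)\<^sup>2 + (g z)\<^sup>2"])
  have [measurable]: "f \<in> borel_measurable \<omega>" "g \<in> borel_measurable \<omega>"
    using assms unfolding L2_fun_def by auto
  show "(\<lambda>z. f z * g z) \<in> borel_measurable \<omega>" by measurable
  show "integrable \<omega> (\<lambda>z. (f z)\<^sup>2 + (g z)\<^sup>2)"
    using assms unfolding L2_fun_def by auto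
  have "\<bar>a * b\<bar> \<le> a\<^sup>2 + b\<^sup>2" for a b :: real
  proof -
    have "0 \<le> \<bar>a * b\<bar>" by simp
    moreover have "2 * \<bar>a * b\<bar> \<le> a\<^sup>2 + b\<^sup>2"
      using sum_squares_bound[of "\<bar>a\<bar>" "\<bar>b\<bar>"] by (simp add: abs_mult)
    ultimately show ?thesis by linarith
  qed
  then show "AE z in \<omega>. norm (f z * g z) \<le> norm ((f z)\<^sup>2 + (g z)\<^sup>2)" by auto
qed

lemma L2_Cauchy_Schwarz:
  assumes "f \<in> L2_fun \<omega>" "g \<in> L2_fun \<omega>"
  shows "\<bar>\<integral>z. f z * g z \<partial>\<omega>\<bar> \<le> L2_fun_norm \<omega> f * L2_fun_norm \<omega> g"
proof -
  have int: "integrable \<omega> (\<lambda>z. (f z)\<^sup>2)" "integrable \<omega> (\<lambda>z. (g z)\<^sup>2)"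
    "integrable \<omega> (\<lambda>z. f z * g z)"
    using assms L2_fun_prod_integrable[OF assms] unfolding L2_fun_def by auto
  have "(\<integral>z. f z * g z \<partial>\<omega>)\<^sup>2 \<le> (\<integral>z. (f z)\<^sup>2 \<partial>\<omega>) * (\<integral>z. (g z)\<^sup>2 \<partial>\<omega>)"
  proof (rule quadratic_nonneg_discriminant)
    fix t :: real
    have "0 \<le> (\<integral>z. (f z - t * g z)\<^sup>2 \<partial>\<omega>)" by simp
    also have "\<dots> = (\<integral>z. (f z)\<^sup>2 - (2 * t) * (f z * g z) + t\<^sup>2 * (g z)\<^sup>2 \<partial>\<omega>)"
      by (intro Bochner_Integration.integral_cong) (auto simp: power2_eq_square algebra_simps)
    also have "\<dots> = (\<integral>z. (f z)\<^sup>2 \<partial>\<omega>) - 2 * t * (\<integral>z. f z * g z \<partial>\<omega>) + t\<^sup>2 * (\<integral>z. (g z)\<^sup>2 \<partial>\<omega>)"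
      using int by simp
    finally show "0 \<le> \<dots>" .
  qed simp
  then have "\<bar>\<integral>z. f z * g z \<partial>\<omega>\<bar>\<^sup>2 \<le> (L2_fun_norm \<omega> f * L2_fun_norm \<omega> g)\<^sup>2"
    by (simp add: power_mult_distrib L2_fun_norm_power2)
  then show ?thesis
    by (rule power2_le_imp_le) (simp add: L2_fun_norm_nonneg)
qed

lemma bdd_fun_L2:
  assumes "finite_measure \<omega>" "f \<in> bdd_fun \<omega>" shows "f \<in> L2_fun \<omega>"
  using bdd_fun_integrable[OF assms(1) refl bdd_fun_power2[OF assms(2)]] assms(2)
  unfolding L2_fun_def by (auto dest: bdd_fun_measurable)

section \<open>The convergence rate\<close>

text \<open>
  Truncate a test function \<open>f\<close> at height \<open>k\<close> and recentre it: the results are bounded, have mean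
  zero, and their norms tend to that of \<open>f\<close>, so the estimate passes to the limit.
\<close>

lemma L2_dist_le_boundedI:
  fixes C :: real
  assumes "prob_space \<omega>" "prob_space \<nu>" and sets: "sets \<nu> = sets \<omega>" and "0 \<le> C"
    and bound: "\<And>f. f \<in> bdd_fun \<omega> \<Longrightarrow> (\<integral>z. f z \<partial>\<omega>) = 0 \<Longrightarrow> \<bar>\<integral>z. f z \<partial>\<nu>\<bar> \<le> C * L2_fun_norm \<omega> f"
  shows "L2_dist \<omega> \<nu> \<omega> \<le> ennreal C"
  unfolding L2_dist_def
proof (rule SUP_least)
  interpret \<omega>: prob_space \<omega> by fact
  interpret \<nu>: prob_space \<nu> by fact
  fix f assume f: "f \<in> {f \<in> L2_fun0 \<omega>. L2_fun_norm \<omega> f = 1}"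
  then have [measurable]: "f \<in> borel_measurable \<omega>" and sq: "integrable \<omega> (\<lambda>z. (f z)\<^sup>2)"
    and mean: "(\<integral>z. f z \<partial>\<omega>) = 0" and norm: "(\<integral>z. (f z)\<^sup>2 \<partial>\<omega>) = 1"
    unfolding L2_fun0_def L2_fun_def L2_fun_norm_def by auto
  have [measurable]: "f \<in> borel_measurable \<nu>"
    using sets by (simp cong: measurable_cong_sets)
  have int: "integrable \<omega> f" by (rule \<omega>.square_integrable_imp_integrable) (use sq in auto)
  have "\<bar>\<integral>z. f z \<partial>\<nu>\<bar> \<le> C"
  proof (cases "integrable \<nu> f")
    case False
    then show ?thesis using \<open>0 \<le> C\<close> by (simp add: not_integrable_integral_eq)
  next
    case True
    \<comment> \<open>if \<open>f\<close> is \<open>\<nu>\<close>-integrable, truncation converges; otherwise its integral is \<open>0\<close> by convention\<close>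
    define F where "F k z = max (- real k) (min (real k) (f z))" for k z
    define m where "m k = (\<integral>z. F k z \<partial>\<omega>)" for k
    have F_meas [measurable]: "F k \<in> borel_measurable \<omega>" "F k \<in> borel_measurable \<nu>" for k
      unfolding F_def by measurable
    have F_bd: "\<bar>F k z\<bar> \<le> real k" and F_le: "\<bar>F k z\<bar> \<le> \<bar>f z\<bar>" for k z
      unfolding F_def by auto
    have F_bdd: "F k \<in> bdd_fun \<omega>" for k by (rule bdd_funI[OF F_meas(1) F_bd])
    have F_lim: "(\<lambda>k. F k z) \<longlonglongrightarrow> f z" for z
    proof (rule tendsto_eventually)
      obtain n where "\<bar>f z\<bar> \<le> real n" using real_arch_simple by blast
      then show "\<forall>\<^sub>F k in sequentially. F k z = f z"
        unfolding eventually_sequentially F_def by (intro exI[of _ n]) (auto simp: min_def max_def)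
    qed
    have lim_\<nu>: "(\<lambda>k. \<integral>z. F k z \<partial>\<nu>) \<longlonglongrightarrow> (\<integral>z. f z \<partial>\<nu>)"
      by (rule integral_dominated_convergence[where w="\<lambda>z. \<bar>f z\<bar>"])
         (use True F_lim F_le in auto)
    have lim_m: "m \<longlonglongrightarrow> 0"
      unfolding m_def mean[symmetric]
      by (rule integral_dominated_convergence[where w="\<lambda>z. \<bar>f z\<bar>"])
         (use int F_lim F_le in auto)
    have lim_sq: "(\<lambda>k. \<integral>z. (F k z)\<^sup>2 \<partial>\<omega>) \<longlonglongrightarrow> 1"
      unfolding norm[symmetric]
    proof (rule integral_dominated_convergence[where w="\<lambda>z. (f z)\<^sup>2"])
      show "AE z in \<omega>. (\<lambda>k. (F k z)\<^sup>2) \<longlonglongrightarrow> (f z)\<^sup>2"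
        using F_lim by (intro AE_I2 tendsto_power)
      show "AE z in \<omega>. norm ((F k z)\<^sup>2) \<le> (f z)\<^sup>2" for k
        using F_le[of k] by (intro AE_I2) (simp add: abs_le_square_iff[THEN iffD1])
    qed (use sq in auto)
    have norm_eq: "L2_fun_norm \<omega> (\<lambda>z. F k z - m k) = sqrt ((\<integral>z. (F k z)\<^sup>2 \<partial>\<omega>) - (m k)\<^sup>2)" for k
    proof -
      have i: "integrable \<omega> (F k)" "integrable \<omega> (\<lambda>z. (F k z)\<^sup>2)"
        using F_bdd bdd_fun_power2[OF F_bdd]
        by (auto intro: bdd_fun_integrable[OF \<omega>.finite_measure_axioms refl])
      have "(\<integral>z. (F k z - m k)\<^sup>2 \<partial>\<omega>) = (\<integral>z. (F k z)\<^sup>2 - (2 * m k) * F k z + (m k)\<^sup>2 \<partial>\<omega>)"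
        by (intro Bochner_Integration.integral_cong) (auto simp: power2_eq_square algebra_simps)
      also have "\<dots> = (\<integral>z. (F k z)\<^sup>2 \<partial>\<omega>) - (2 * m k) * m k + (m k)\<^sup>2"
        using i by (simp add: m_def \<omega>.prob_space)
      finally show ?thesis unfolding L2_fun_norm_def by (simp add: power2_eq_square)
    qed
    have le: "\<bar>(\<integral>z. F k z \<partial>\<nu>) - m k\<bar> \<le> C * sqrt ((\<integral>z. (F k z)\<^sup>2 \<partial>\<omega>) - (m k)\<^sup>2)" for k
    proof -
      have i: "integrable \<omega> (F k)" "integrable \<nu> (F k)"
        using bdd_fun_integrable[OF \<omega>.finite_measure_axioms refl F_bdd]
          bdd_fun_integrable[OF \<nu>.finite_measure_axioms sets F_bdd] .
      have "\<bar>\<integral>z. F k z - m k \<partial>\<nu>\<bar> \<le> C * L2_fun_norm \<omega> (\<lambda>z. F k z - m k)"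
        by (rule bound) (use i in \<open>auto intro!: bdd_fun_closed F_bdd simp: m_def \<omega>.prob_space\<close>)
      then show ?thesis using i unfolding norm_eq by (simp add: \<nu>.prob_space)
    qed
    have "(\<lambda>k. \<bar>(\<integral>z. F k z \<partial>\<nu>) - m k\<bar>) \<longlonglongrightarrow> \<bar>(\<integral>z. f z \<partial>\<nu>) - 0\<bar>"
      by (intro tendsto_rabs tendsto_diff lim_\<nu> lim_m)
    moreover have "(\<lambda>k. C * sqrt ((\<integral>z. (F k z)\<^sup>2 \<partial>\<omega>) - (m k)\<^sup>2)) \<longlonglongrightarrow> C * sqrt (1 - 0\<^sup>2)"
      by (intro tendsto_mult tendsto_const tendsto_real_sqrt tendsto_diff tendsto_power lim_sq lim_m)
    ultimately have "\<bar>(\<integral>z. f z \<partial>\<nu>) - 0\<bar> \<le> C * sqrt (1 - 0\<^sup>2)"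
      by (rule LIMSEQ_le) (use le in blast)
    then show ?thesis by simp
  qed
  then show "ennreal \<bar>(\<integral>z. f z \<partial>\<nu>) - (\<integral>z. f z \<partial>\<omega>)\<bar> \<le> ennreal C"
    by (simp add: mean ennreal_leI)
qed

text \<open>
  The set whose infimum is \<^const>\<open>L2_rate\<close>.
\<close>

definition geometric_rates :: "'a measure \<Rightarrow> ('a \<Rightarrow> 'a measure) \<Rightarrow> real set" where
  "geometric_rates \<omega> P = {\<rho> \<in> {0..1}. \<forall>\<mu> \<in> L2_star \<omega>. \<exists>C::real. \<forall>n>0.
     L2_dist \<omega> (\<mu> \<bind> kernel_pow \<omega> P n) \<omega> < ennreal (C * \<rho> ^ n)}"

lemma L2_rate_le: "\<rho> \<in> geometric_rates \<omega> P \<Longrightarrow> L2_rate \<omega> P \<le> \<rho>"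
  unfolding L2_rate_def geometric_rates_def[symmetric]
  by (rule cInf_lower) (auto simp: geometric_rates_def intro!: bdd_belowI[of _ 0])

lemma L2_rate_lessD:
  assumes "L2_rate \<omega> P < c" "geometric_rates \<omega> P \<noteq> {}"
  obtains \<rho> where "\<rho> \<in> geometric_rates \<omega> P" "\<rho> < c"
  using cInf_lessD[of "geometric_rates \<omega> P" c] assms
  unfolding L2_rate_def geometric_rates_def[symmetric] by blast

section \<open>Markov kernels as operators on bounded functions\<close>

definition kernel_op :: "('a \<Rightarrow> 'a measure) \<Rightarrow> ('a \<Rightarrow> real) \<Rightarrow> 'a \<Rightarrow> real" where
  "kernel_op K f z = (\<integral>z'. f z' \<partial>K z)"

locale markov_kernel = prob_space \<omega> for \<omega> :: "'a measure" +
  fixes K :: "'a \<Rightarrow> 'a measure"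
  assumes kernel [measurable]: "K \<in> \<omega> \<rightarrow>\<^sub>M prob_algebra \<omega>"
begin

lemma prob_space_kernel: "z \<in> space \<omega> \<Longrightarrow> prob_space (K z)"
  and sets_kernel_eq: "z \<in> space \<omega> \<Longrightarrow> sets (K z) = sets \<omega>"
  using measurable_space[OF kernel] by (auto simp: space_prob_algebra)

lemma kernel_integrable: "f \<in> bdd_fun \<omega> \<Longrightarrow> z \<in> space \<omega> \<Longrightarrow> integrable (K z) f"
  by (rule bdd_fun_integrable[OF _ sets_kernel_eq])
     (auto intro: prob_space.finite_measure prob_space_kernel)

lemma bdd_integrable: "f \<in> bdd_fun \<omega> \<Longrightarrow> integrable \<omega> f"
  by (rule bdd_fun_integrable[OF finite_measure_axioms refl])

lemma bdd_L2: "f \<in> bdd_fun \<omega> \<Longrightarrow> f \<in> L2_fun \<omega>"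
  by (rule bdd_fun_L2[OF finite_measure_axioms])

lemma kernel_op_abs_le:
  assumes "f \<in> bdd_fun \<omega>" "z \<in> space \<omega>" "\<And>z. z \<in> space \<omega> \<Longrightarrow> \<bar>f z\<bar> \<le> b"
  shows "\<bar>kernel_op K f z\<bar> \<le> b"
proof -
  interpret Kz: prob_space "K z" using assms(2) by (rule prob_space_kernel)
  have sp: "space (K z) = space \<omega>" using sets_kernel_eq[OF assms(2)] by (rule sets_eq_imp_space_eq)
  have "\<bar>kernel_op K f z\<bar> \<le> (\<integral>z'. \<bar>f z'\<bar> \<partial>K z)"
    unfolding kernel_op_def by simp
  also have "\<dots> \<le> (\<integral>z'. b \<partial>K z)"
    using assms kernel_integrable[OF assms(1,2)] sp by (intro integral_mono) auto
  finally show ?thesis by (simp add: Kz.prob_space)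
qed

lemma kernel_op_bdd:
  assumes "f \<in> bdd_fun \<omega>" shows "kernel_op K f \<in> bdd_fun \<omega>"
proof -
  obtain b where b: "\<And>z. z \<in> space \<omega> \<Longrightarrow> \<bar>f z\<bar> \<le> b" by (rule bdd_funE[OF assms]) blast
  have "kernel_op K f \<in> borel_measurable \<omega>"
    unfolding kernel_op_def
    by (rule measurable_compose[OF measurable_prob_algebraD[OF kernel]
          integral_measurable_subprob_algebra[OF bdd_fun_measurable[OF assms]]])
  then show ?thesis using kernel_op_abs_le[OF assms _ b] by (rule bdd_funI)
qed

lemma kernel_op_pow_bdd: "f \<in> bdd_fun \<omega> \<Longrightarrow> (kernel_op K ^^ n) f \<in> bdd_fun \<omega>"
  by (induction n) (auto intro: kernel_op_bdd)

lemma kernel_op_diff: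
  "f \<in> bdd_fun \<omega> \<Longrightarrow> g \<in> bdd_fun \<omega> \<Longrightarrow> z \<in> space \<omega> \<Longrightarrow>
    kernel_op K (\<lambda>z. f z - g z) z = kernel_op K f z - kernel_op K g z"
  unfolding kernel_op_def by (simp add: kernel_integrable)

lemma kernel_op_cong:
  "z \<in> space \<omega> \<Longrightarrow> (\<And>z. z \<in> space \<omega> \<Longrightarrow> f z = g z) \<Longrightarrow> kernel_op K f z = kernel_op K g z"
  unfolding kernel_op_def using sets_eq_imp_space_eq[OF sets_kernel_eq]
  by (intro Bochner_Integration.integral_cong) auto

lemma kernel_op_power2_le:
  assumes f: "f \<in> bdd_fun \<omega>" and z: "z \<in> space \<omega>"
  shows "(kernel_op K f z)\<^sup>2 \<le> kernel_op K (\<lambda>z. (f z)\<^sup>2) z"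
proof -
  interpret Kz: prob_space "K z" using z by (rule prob_space_kernel)
  have "f \<in> bdd_fun (K z)" using f sets_kernel_eq[OF z] bdd_fun_cong by blast
  then have "(\<lambda>_. 1) \<in> L2_fun (K z)" "f \<in> L2_fun (K z)"
    by (simp_all add: bdd_fun_L2[OF Kz.finite_measure_axioms] bdd_fun_const)
  from L2_Cauchy_Schwarz[OF this]
  have "\<bar>kernel_op K f z\<bar> \<le> L2_fun_norm (K z) f"
    by (simp add: kernel_op_def L2_fun_norm_def Kz.prob_space)
  from power_mono[OF this, of 2] show ?thesis
    by (simp add: L2_fun_norm_power2 kernel_op_def)
qed

lemma kernel_pow_kernel [measurable]: "kernel_pow \<omega> K n \<in> \<omega> \<rightarrow>\<^sub>M prob_algebra \<omega>"
proof (induction n)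
  case (Suc n)
  then show ?case by (simp add: measurable_bind_prob_space[OF kernel])
qed simp

lemma integral_bind_bdd:
  assumes "prob_space \<mu>" "sets \<mu> = sets \<omega>" "L \<in> \<omega> \<rightarrow>\<^sub>M prob_algebra \<omega>" "f \<in> bdd_fun \<omega>"
  shows "(\<integral>z. f z \<partial>(\<mu> \<bind> L)) = (\<integral>z. \<integral>z'. f z' \<partial>L z \<partial>\<mu>)"
proof -
  obtain b where b: "\<And>z. z \<in> space \<omega> \<Longrightarrow> \<bar>f z\<bar> \<le> b" by (rule bdd_funE[OF assms(4)]) blast
  have L: "L \<in> \<mu> \<rightarrow>\<^sub>M subprob_algebra \<omega>"
    using assms(2) measurable_prob_algebraD[OF assms(3)] measurable_cong_sets by blast
  have "emeasure (L z) (space (L z)) \<le> ennreal 1" if "z \<in> space \<mu>" for z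
    using subprob_space.emeasure_space_le_1[OF subprob_space_kernel[OF L that]] by simp
  then show ?thesis
    by (intro integral_bind[OF bdd_fun_measurable[OF assms(4)] b L, where B'=1]
        prob_space.finite_measure assms(1)) auto
qed

lemma integral_kernel_pow:
  "f \<in> bdd_fun \<omega> \<Longrightarrow> z \<in> space \<omega> \<Longrightarrow>
    (\<integral>z'. f z' \<partial>kernel_pow \<omega> K n z) = (kernel_op K ^^ n) f z"
proof (induction n arbitrary: z)
  case 0
  then show ?case using integral_return[of z \<omega> f] bdd_fun_measurable by simp
next
  case (Suc n)
  have "(\<integral>z'. f z' \<partial>kernel_pow \<omega> K (Suc n) z) = kernel_op K (\<lambda>z. \<integral>z'. f z' \<partial>kernel_pow \<omega> K n z) z"
    unfolding kernel_op_def kernel_pow.simps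
    using Suc.prems prob_space_kernel sets_kernel_eq kernel_pow_kernel by (intro integral_bind_bdd) auto
  also have "\<dots> = kernel_op K ((kernel_op K ^^ n) f) z"
    using Suc by (intro kernel_op_cong) auto
  finally show ?case by simp
qed

lemma integral_bind_kernel_pow:
  assumes "prob_space \<mu>" "sets \<mu> = sets \<omega>" "f \<in> bdd_fun \<omega>"
  shows "(\<integral>z. f z \<partial>(\<mu> \<bind> kernel_pow \<omega> K n)) = (\<integral>z. (kernel_op K ^^ n) f z \<partial>\<mu>)"
  unfolding integral_bind_bdd[OF assms(1,2) kernel_pow_kernel assms(3)]
  using integral_kernel_pow[OF assms(3)] sets_eq_imp_space_eq[OF assms(2)]
  by (intro Bochner_Integration.integral_cong) auto

text \<open>
  With \<open>g\<close> the density of a starting distribution \<open>\<mu>\<close>, the integral of \<open>f\<close> against \<open>\<mu> K\<^sup>n\<close> is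
  \<open>\<langle>g, K\<^sup>n f\<rangle>\<close>.  Hence decay of \<open>K\<^sup>n f\<close> for bounded \<open>f\<close>, combined with the
  Cauchy-Schwarz inequality, yields decay of the distance to \<open>\<omega>\<close>.
\<close>

lemma geometric_ratesI:
  assumes "0 < \<kappa>" "\<kappa> \<le> 1" "0 \<le> c"
    and contr: "\<And>n f. 0 < n \<Longrightarrow> f \<in> bdd_fun \<omega> \<Longrightarrow> (\<integral>z. f z \<partial>\<omega>) = 0 \<Longrightarrow>
      L2_fun_norm \<omega> ((kernel_op K ^^ n) f) \<le> c * \<kappa> ^ n * L2_fun_norm \<omega> f"
  shows "\<kappa> \<in> geometric_rates \<omega> K"
  unfolding geometric_rates_def
proof (safe, goal_cases)
  case (2 \<mu>)
  then have \<mu>: "prob_space \<mu>" "sets \<mu> = sets \<omega>" "absolutely_continuous \<omega> \<mu>"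
    and fin: "(\<integral>\<^sup>+ z. (RN_deriv \<omega> \<mu> z)\<^sup>2 \<partial>\<omega>) < \<infinity>"
    unfolding L2_star_def by auto
  interpret \<mu>: prob_space \<mu> by fact
  define g where "g z = enn2real (RN_deriv \<omega> \<mu> z)" for z
  have [measurable]: "g \<in> borel_measurable \<omega>" unfolding g_def by measurable
  have "AE z in \<omega>. RN_deriv \<omega> \<mu> z \<noteq> \<infinity>"
    using \<mu> by (intro RN_deriv_finite \<mu>.sigma_finite_measure_axioms)
  then have "(\<integral>\<^sup>+ z. ennreal ((g z)\<^sup>2) \<partial>\<omega>) = (\<integral>\<^sup>+ z. (RN_deriv \<omega> \<mu> z)\<^sup>2 \<partial>\<omega>)"
    unfolding g_def by (intro nn_integral_cong_AE) (auto simp: less_top simp flip: ennreal_power)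
  with fin have "integrable \<omega> (\<lambda>z. (g z)\<^sup>2)"
    by (intro integrableI_nonneg) auto
  then have g: "g \<in> L2_fun \<omega>" unfolding L2_fun_def by simp
  define G where "G = L2_fun_norm \<omega> g"
  have G: "0 \<le> G" unfolding G_def by (rule L2_fun_norm_nonneg)
  have "L2_dist \<omega> (\<mu> \<bind> kernel_pow \<omega> K n) \<omega> < ennreal ((G * c + 1) * \<kappa> ^ n)" if "0 < n" for n
  proof -
    have \<mu>_in: "\<mu> \<in> space (prob_algebra \<omega>)" using \<mu> by (simp add: space_prob_algebra)
    have "L2_dist \<omega> (\<mu> \<bind> kernel_pow \<omega> K n) \<omega> \<le> ennreal (G * c * \<kappa> ^ n)"
    proof (rule L2_dist_le_boundedI)
      show "prob_space (\<mu> \<bind> kernel_pow \<omega> K n)" "sets (\<mu> \<bind> kernel_pow \<omega> K n) = sets \<omega>"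
        using prob_space_bind'[OF \<mu>_in kernel_pow_kernel] sets_bind'[OF \<mu>_in kernel_pow_kernel] .
      fix f assume f: "f \<in> bdd_fun \<omega>" "(\<integral>z. f z \<partial>\<omega>) = 0"
      let ?h = "(kernel_op K ^^ n) f"
      have h: "?h \<in> bdd_fun \<omega>" using f(1) by (rule kernel_op_pow_bdd)
      have "\<bar>\<integral>z. f z \<partial>(\<mu> \<bind> kernel_pow \<omega> K n)\<bar> = \<bar>\<integral>z. g z * ?h z \<partial>\<omega>\<bar>"
        unfolding integral_bind_kernel_pow[OF \<mu>(1,2) f(1)] g_def
        using RN_deriv_integral[OF \<mu>.sigma_finite_measure_axioms \<mu>(3,2) bdd_fun_measurable[OF h]]
        by simp
      also have "\<dots> \<le> G * L2_fun_norm \<omega> ?h"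
        unfolding G_def by (intro L2_Cauchy_Schwarz g bdd_L2 h)
      also have "\<dots> \<le> G * (c * \<kappa> ^ n * L2_fun_norm \<omega> f)"
        using contr[OF that f] G by (rule mult_left_mono)
      finally show "\<bar>\<integral>z. f z \<partial>(\<mu> \<bind> kernel_pow \<omega> K n)\<bar> \<le> G * c * \<kappa> ^ n * L2_fun_norm \<omega> f"
        by (simp add: mult.assoc)
    qed (use assms G in \<open>auto intro: prob_space_axioms\<close>)
    also have "\<dots> < ennreal ((G * c + 1) * \<kappa> ^ n)"
      using assms(1,3) G by (intro ennreal_lessI add_nonneg_pos mult_pos_pos) (auto simp: distrib_right)
    finally show ?thesis .
  qed
  then show ?case by blast
qed (use assms in auto)

end

section \<open>Reversible kernels and their spectral gap\<close>

text \<open>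
  Log-convexity makes the ratios \<open>s (k + 1) / s k\<close> increasing, so that \<open>s k \<ge> t\<^sup>k s 0\<close> with
  \<open>t = s 1 / s 0\<close>; if \<open>t > q\<close>, this outgrows \<open>D q\<^sup>k\<close>.
\<close>

lemma ratio_le_of_log_convex:
  fixes s :: "nat \<Rightarrow> real"
  assumes nonneg: "\<And>k. 0 \<le> s k" and convex: "\<And>k. (s (Suc k))\<^sup>2 \<le> s k * s (Suc (Suc k))"
    and q: "0 \<le> q" and decay: "\<And>k. 0 < k \<Longrightarrow> s k \<le> D * q ^ k"
  shows "s 1 \<le> q * s 0"
proof (rule ccontr)
  assume "\<not> s 1 \<le> q * s 0"
  then have less: "q * s 0 < s 1" by simp
  have s1: "0 < s 1" using less q nonneg[of 0] by (smt (verit) mult_nonneg_nonneg)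
  have s0: "0 < s 0"
    using convex[of 0] nonneg[of 0] s1 by (cases "s 0 = 0") auto
  define t where "t = s 1 / s 0"
  have t: "0 < t" "q < t" unfolding t_def using s0 s1 less by (auto simp: field_simps)
  have growth: "0 < s k \<and> t * s k \<le> s (Suc k)" for k
  proof (induction k)
    case 0
    then show ?case using s0 by (simp add: t_def)
  next
    case (Suc k)
    then have pos: "0 < s k" "0 < s (Suc k)" using t by (auto intro: less_le_trans[OF mult_pos_pos])
    have "(t * s (Suc k)) * s k = s (Suc k) * (t * s k)" by simp
    also have "\<dots> \<le> s (Suc k) * s (Suc k)" using Suc pos by (intro mult_left_mono) auto
    also have "\<dots> \<le> s (Suc (Suc k)) * s k" using convex[of k] by (simp add: power2_eq_square mult.commute)
    finally show ?case using pos by (simp add: mult_le_cancel_right)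
  qed
  have lower: "t ^ k * s 0 \<le> s k" for k
  proof (induction k)
    case (Suc k)
    have "t ^ Suc k * s 0 = t * (t ^ k * s 0)" by simp
    also have "\<dots> \<le> t * s k" using Suc t by (intro mult_left_mono) auto
    also have "\<dots> \<le> s (Suc k)" using growth by blast
    finally show ?case .
  qed simp
  have "(\<lambda>k. D * (q / t) ^ k) \<longlonglongrightarrow> D * 0"
    using q t by (intro tendsto_mult tendsto_const LIMSEQ_realpow_zero) auto
  moreover have "s 0 \<le> D * (q / t) ^ k" if "0 < k" for k
  proof -
    have "t ^ k * s 0 \<le> D * q ^ k" using lower[of k] decay[OF that] by linarith
    then show ?thesis using t by (simp add: power_divide field_simps)
  qed
  ultimately have "s 0 \<le> D * 0"
    by (intro LIMSEQ_le_const) (auto intro!: exI[of _ 1])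
  then show False using s0 by simp
qed

text \<open>
  Adding a constant makes a bounded function nonnegative.  Statements about nonnegative
  integrals, where measurability alone suffices, are carried over to bounded functions in this
  way.
\<close>

lemma (in prob_space) shifted_nn_integral:
  assumes "sets M = sets N" "f \<in> bdd_fun N" "\<And>z. z \<in> space M \<Longrightarrow> 0 \<le> f z + b"
  shows "(\<integral>\<^sup>+ z. ennreal (f z + b) \<partial>M) = ennreal ((\<integral>z. f z \<partial>M) + b)"
    and "0 \<le> (\<integral>z. f z \<partial>M) + b"
proof -
  have int: "integrable M f" using assms bdd_fun_integrable finite_measure_axioms by blast
  then have eq: "(\<integral>z. f z + b \<partial>M) = (\<integral>z. f z \<partial>M) + b" by (simp add: prob_space)
  show "(\<integral>\<^sup>+ z. ennreal (f z + b) \<partial>M) = ennreal ((\<integral>z. f z \<partial>M) + b)"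
    unfolding eq[symmetric] using int assms(3) by (intro nn_integral_eq_integral) auto
  have "0 \<le> (\<integral>z. f z + b \<partial>M)" using assms(3) by (intro integral_nonneg_AE AE_I2) auto
  then show "0 \<le> (\<integral>z. f z \<partial>M) + b" using eq by simp
qed

text \<open>
  Detailed balance is stated for nonnegative functions, which is the form that Tonelli's theorem
  proves for a concrete kernel.
\<close>

locale reversible_kernel = markov_kernel +
  assumes reversible: "\<And>f g. f \<in> borel_measurable \<omega> \<Longrightarrow> g \<in> borel_measurable \<omega> \<Longrightarrow>
    (\<integral>\<^sup>+ z. f z * (\<integral>\<^sup>+ z'. g z' \<partial>K z) \<partial>\<omega>) = (\<integral>\<^sup>+ z. g z * (\<integral>\<^sup>+ z'. f z' \<partial>K z) \<partial>\<omega>)"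
begin

lemma nn_integral_invariant:
  assumes [measurable]: "g \<in> borel_measurable \<omega>"
  shows "(\<integral>\<^sup>+ z. \<integral>\<^sup>+ z'. g z' \<partial>K z \<partial>\<omega>) = (\<integral>\<^sup>+ z. g z \<partial>\<omega>)"
proof -
  have "(\<integral>\<^sup>+ z. \<integral>\<^sup>+ z'. g z' \<partial>K z \<partial>\<omega>) = (\<integral>\<^sup>+ z. g z * (\<integral>\<^sup>+ z'. 1 \<partial>K z) \<partial>\<omega>)"
    using reversible[of "\<lambda>_. 1" g] by simp
  also have "\<dots> = (\<integral>\<^sup>+ z. g z \<partial>\<omega>)"
    by (intro nn_integral_cong) (simp add: prob_space.emeasure_space_1[OF prob_space_kernel])
  finally show ?thesis .
qed

lemma integral_kernel_op:
  assumes f: "f \<in> bdd_fun \<omega>"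
  shows "(\<integral>z. kernel_op K f z \<partial>\<omega>) = (\<integral>z. f z \<partial>\<omega>)"
proof -
  obtain b where b: "\<And>z. z \<in> space \<omega> \<Longrightarrow> \<bar>f z\<bar> \<le> b" by (rule bdd_funE[OF f]) blast
  have pos: "0 \<le> f z + b" if "z \<in> space \<omega>" for z using b[OF that] by linarith
  note [measurable] = bdd_fun_measurable[OF f]
  have K: "(\<integral>\<^sup>+ z'. ennreal (f z' + b) \<partial>K z) = ennreal (kernel_op K f z + b)"
      "0 \<le> kernel_op K f z + b" if "z \<in> space \<omega>" for z
    unfolding kernel_op_def
    using prob_space.shifted_nn_integral[OF prob_space_kernel[OF that] sets_kernel_eq[OF that] f, of b]
      pos sets_eq_imp_space_eq[OF sets_kernel_eq[OF that]] by auto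
  have "ennreal ((\<integral>z. kernel_op K f z \<partial>\<omega>) + b) = (\<integral>\<^sup>+ z. ennreal (kernel_op K f z + b) \<partial>\<omega>)"
    using shifted_nn_integral(1)[OF refl kernel_op_bdd[OF f] K(2)] by simp
  also have "\<dots> = (\<integral>\<^sup>+ z. \<integral>\<^sup>+ z'. ennreal (f z' + b) \<partial>K z \<partial>\<omega>)"
    by (intro nn_integral_cong) (simp add: K)
  also have "\<dots> = ennreal ((\<integral>z. f z \<partial>\<omega>) + b)"
    by (simp add: nn_integral_invariant shifted_nn_integral(1)[OF refl f pos])
  finally show ?thesis
    using shifted_nn_integral(2)[OF refl kernel_op_bdd[OF f] K(2)] shifted_nn_integral(2)[OF refl f pos]
    by simp
qed

text \<open>
  Apply detailed balance to \<open>f + a\<close> and \<open>g + b\<close>, which are nonnegative, and expand: the terms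
  that involve \<open>a\<close> or \<open>b\<close> agree on both sides because \<open>\<omega>\<close> is invariant.
\<close>

lemma kernel_op_symmetric:
  assumes f: "f \<in> bdd_fun \<omega>" and g: "g \<in> bdd_fun \<omega>"
  shows "(\<integral>z. f z * kernel_op K g z \<partial>\<omega>) = (\<integral>z. kernel_op K f z * g z \<partial>\<omega>)"
proof -
  obtain a where a: "0 < a" "\<And>z. z \<in> space \<omega> \<Longrightarrow> \<bar>f z\<bar> \<le> a" by (rule bdd_funE[OF f]) blast
  obtain b where b: "0 < b" "\<And>z. z \<in> space \<omega> \<Longrightarrow> \<bar>g z\<bar> \<le> b" by (rule bdd_funE[OF g]) blast
  have pos: "0 \<le> f z + a" "0 \<le> g z + b" if "z \<in> space \<omega>" for z
    using a(2)[OF that] b(2)[OF that] by linarith+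
  \<comment> \<open>the expansion of one side; the other side follows by exchanging the roles of \<open>f\<close> and \<open>g\<close>\<close>
  have half: "(\<integral>\<^sup>+ z. ennreal (u z + c) * (\<integral>\<^sup>+ z'. ennreal (v z' + d) \<partial>K z) \<partial>\<omega>) =
      ennreal ((\<integral>z. u z * kernel_op K v z \<partial>\<omega>) + d * (\<integral>z. u z \<partial>\<omega>) + c * (\<integral>z. v z \<partial>\<omega>) + c * d)"
    "0 \<le> (\<integral>z. u z * kernel_op K v z \<partial>\<omega>) + d * (\<integral>z. u z \<partial>\<omega>) + c * (\<integral>z. v z \<partial>\<omega>) + c * d"
    if u: "u \<in> bdd_fun \<omega>" and v: "v \<in> bdd_fun \<omega>"
      and uc: "\<And>z. z \<in> space \<omega> \<Longrightarrow> 0 \<le> u z + c" and vd: "\<And>z. z \<in> space \<omega> \<Longrightarrow> 0 \<le> v z + d" for u v c d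
  proof -
    note Kv = kernel_op_bdd[OF v]
    have K: "(\<integral>\<^sup>+ z'. ennreal (v z' + d) \<partial>K z) = ennreal (kernel_op K v z + d)"
        "0 \<le> kernel_op K v z + d" if "z \<in> space \<omega>" for z
      unfolding kernel_op_def
      using prob_space.shifted_nn_integral[OF prob_space_kernel[OF that] sets_kernel_eq[OF that] v, of d]
        vd sets_eq_imp_space_eq[OF sets_kernel_eq[OF that]] by auto
    have bdd: "(\<lambda>z. (u z + c) * (kernel_op K v z + d)) \<in> bdd_fun \<omega>"
      by (intro bdd_fun_closed u Kv)
    have "(\<integral>\<^sup>+ z. ennreal (u z + c) * (\<integral>\<^sup>+ z'. ennreal (v z' + d) \<partial>K z) \<partial>\<omega>) =
        (\<integral>\<^sup>+ z. ennreal ((u z + c) * (kernel_op K v z + d)) \<partial>\<omega>)"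
      by (intro nn_integral_cong) (simp add: K uc ennreal_mult)
    also have "\<dots> = ennreal (\<integral>z. (u z + c) * (kernel_op K v z + d) \<partial>\<omega>)"
      using uc K(2) by (intro nn_integral_eq_integral bdd_integrable[OF bdd] AE_I2) auto
    finally have 1: "(\<integral>\<^sup>+ z. ennreal (u z + c) * (\<integral>\<^sup>+ z'. ennreal (v z' + d) \<partial>K z) \<partial>\<omega>) =
        ennreal (\<integral>z. (u z + c) * (kernel_op K v z + d) \<partial>\<omega>)" .
    have 2: "0 \<le> (\<integral>z. (u z + c) * (kernel_op K v z + d) \<partial>\<omega>)"
      using uc K(2) by (intro integral_nonneg_AE AE_I2) auto
    have "(\<integral>z. (u z + c) * (kernel_op K v z + d) \<partial>\<omega>) =
        (\<integral>z. u z * kernel_op K v z + d * u z + c * kernel_op K v z + c * d \<partial>\<omega>)"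
      by (intro Bochner_Integration.integral_cong) (auto simp: algebra_simps)
    also have "\<dots> = (\<integral>z. u z * kernel_op K v z \<partial>\<omega>) + d * (\<integral>z. u z \<partial>\<omega>) + c * (\<integral>z. v z \<partial>\<omega>) + c * d"
      using bdd_integrable[OF u] bdd_integrable[OF Kv] bdd_integrable[OF bdd_fun_mult[OF u Kv]]
      by (simp add: integral_kernel_op[OF v] prob_space)
    finally show "(\<integral>\<^sup>+ z. ennreal (u z + c) * (\<integral>\<^sup>+ z'. ennreal (v z' + d) \<partial>K z) \<partial>\<omega>) =
      ennreal ((\<integral>z. u z * kernel_op K v z \<partial>\<omega>) + d * (\<integral>z. u z \<partial>\<omega>) + c * (\<integral>z. v z \<partial>\<omega>) + c * d)"
    "0 \<le> (\<integral>z. u z * kernel_op K v z \<partial>\<omega>) + d * (\<integral>z. u z \<partial>\<omega>) + c * (\<integral>z. v z \<partial>\<omega>) + c * d"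
      using 1 2 by simp_all
  qed
  note [measurable] = bdd_fun_measurable[OF f] bdd_fun_measurable[OF g]
  have "(\<integral>\<^sup>+ z. ennreal (f z + a) * (\<integral>\<^sup>+ z'. ennreal (g z' + b) \<partial>K z) \<partial>\<omega>) =
      (\<integral>\<^sup>+ z. ennreal (g z + b) * (\<integral>\<^sup>+ z'. ennreal (f z' + a) \<partial>K z) \<partial>\<omega>)"
    by (rule reversible) measurable
  then have "(\<integral>z. f z * kernel_op K g z \<partial>\<omega>) = (\<integral>z. g z * kernel_op K f z \<partial>\<omega>)"
    using half[OF f g pos(1) pos(2)] half[OF g f pos(2) pos(1)] by (simp add: mult.commute)
  then show ?thesis by (simp add: mult.commute)
qed

text \<open>
  Jensen's inequality at each point, followed by invariance of \<open>\<omega>\<close>.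
\<close>

lemma kernel_op_norm_power2_le:
  assumes f: "f \<in> bdd_fun \<omega>"
  shows "(\<integral>z. (kernel_op K f z)\<^sup>2 \<partial>\<omega>) \<le> (\<integral>z. (f z)\<^sup>2 \<partial>\<omega>)"
proof -
  have "(\<integral>z. (kernel_op K f z)\<^sup>2 \<partial>\<omega>) \<le> (\<integral>z. kernel_op K (\<lambda>z. (f z)\<^sup>2) z \<partial>\<omega>)"
    using kernel_op_power2_le[OF f] by (intro integral_mono bdd_integrable bdd_fun_power2 kernel_op_bdd f)
  then show ?thesis by (simp add: integral_kernel_op bdd_fun_power2 f)
qed

lemma kernel_op_norm_le: "f \<in> bdd_fun \<omega> \<Longrightarrow> L2_fun_norm \<omega> (kernel_op K f) \<le> L2_fun_norm \<omega> f"
  unfolding L2_fun_norm_def by (intro real_sqrt_le_mono kernel_op_norm_power2_le)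

lemma kernel_op_pow_norm_le:
  "f \<in> bdd_fun \<omega> \<Longrightarrow> L2_fun_norm \<omega> ((kernel_op K ^^ n) f) \<le> L2_fun_norm \<omega> f"
proof (induction n)
  case (Suc n)
  then show ?case
    using kernel_op_norm_le[OF kernel_op_pow_bdd, of f n] by simp
qed simp

text \<open>
  Needed to read a conclusion off an infimum: the infimum of the empty set is unspecified.
\<close>

lemma one_geometric_rate: "1 \<in> geometric_rates \<omega> K"
  by (rule geometric_ratesI[where c=1]) (auto simp: kernel_op_pow_norm_le)

lemma kernel_op_pow_symmetric:
  assumes "f \<in> bdd_fun \<omega>" "g \<in> bdd_fun \<omega>"
  shows "(\<integral>z. f z * (kernel_op K ^^ n) g z \<partial>\<omega>) = (\<integral>z. (kernel_op K ^^ n) f z * g z \<partial>\<omega>)"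
  using assms(1)
proof (induction n arbitrary: f)
  case (Suc n)
  have "(\<integral>z. f z * (kernel_op K ^^ Suc n) g z \<partial>\<omega>) = (\<integral>z. kernel_op K f z * (kernel_op K ^^ n) g z \<partial>\<omega>)"
    using kernel_op_symmetric[OF Suc.prems kernel_op_pow_bdd[OF assms(2)]] by simp
  also have "\<dots> = (\<integral>z. (kernel_op K ^^ n) (kernel_op K f) z * g z \<partial>\<omega>)"
    by (rule Suc.IH[OF kernel_op_bdd[OF Suc.prems]])
  finally show ?case by (simp add: funpow_swap1)
qed simp

lemma integral_kernel_op_pow:
  "f \<in> bdd_fun \<omega> \<Longrightarrow> (\<integral>z. (kernel_op K ^^ n) f z \<partial>\<omega>) = (\<integral>z. f z \<partial>\<omega>)"
  by (induction n) (auto simp: integral_kernel_op kernel_op_pow_bdd)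

text \<open>
  Start the chain with density \<open>1 + f / b\<close>, where \<open>b\<close> bounds \<open>\<bar>f\<bar>\<close>, and test its distance to
  \<open>\<omega>\<close> against the normalised \<open>f\<close>: up to constants this is \<open>\<langle>f, K\<^sup>n f\<rangle>\<close>.
\<close>

lemma geometric_rate_imp_autocorrelation_decay:
  assumes \<rho>: "\<rho> \<in> geometric_rates \<omega> K"
    and f: "f \<in> bdd_fun \<omega>" and mean: "(\<integral>z. f z \<partial>\<omega>) = 0"
  shows "\<exists>D. \<forall>n>0. (\<integral>z. f z * (kernel_op K ^^ n) f z \<partial>\<omega>) \<le> D * \<rho> ^ n"
proof (cases "L2_fun_norm \<omega> f = 0")
  case True
  have "(\<integral>z. f z * (kernel_op K ^^ n) f z \<partial>\<omega>) \<le> 0 * \<rho> ^ n" for n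
    using L2_Cauchy_Schwarz[OF bdd_L2[OF f] bdd_L2[OF kernel_op_pow_bdd[OF f, of n]]] True by simp
  then show ?thesis by blast
next
  case False
  define N where "N = L2_fun_norm \<omega> f"
  have N: "0 < N" using False L2_fun_norm_nonneg[of \<omega> f] unfolding N_def by simp
  obtain b where b: "0 < b" "\<And>z. z \<in> space \<omega> \<Longrightarrow> \<bar>f z\<bar> \<le> b" by (rule bdd_funE[OF f]) blast
  define g where "g z = 1 + f z / b" for z
  have g_bounds: "0 \<le> g z" "g z \<le> 2" if "z \<in> space \<omega>" for z
    using b(1) b(2)[OF that] unfolding g_def by (auto simp: field_simps)
  have g: "g \<in> bdd_fun \<omega>" unfolding g_def divide_inverse by (intro bdd_fun_closed f)
  note [measurable] = bdd_fun_measurable[OF f] bdd_fun_measurable[OF g]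
  define \<mu> where "\<mu> = density \<omega> (\<lambda>z. ennreal (g z))"
  have "(\<integral>z. g z \<partial>\<omega>) = 1"
    using bdd_integrable[OF f] mean unfolding g_def by (simp add: prob_space)
  then have "(\<integral>\<^sup>+ z. ennreal (g z) \<partial>\<omega>) = 1"
    using bdd_integrable[OF g] g_bounds(1) by (subst nn_integral_eq_integral) auto
  then have \<mu>_prob: "prob_space \<mu>"
    unfolding \<mu>_def by (intro prob_spaceI) (simp add: emeasure_density cong: nn_integral_cong)
  have \<mu>_sets: "sets \<mu> = sets \<omega>" unfolding \<mu>_def by simp
  have ac: "absolutely_continuous \<omega> \<mu>" unfolding \<mu>_def by (rule absolutely_continuousI_density) measurable
  have "AE z in \<omega>. ennreal (g z) = RN_deriv \<omega> \<mu> z"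
    by (rule RN_deriv_unique) (simp_all add: \<mu>_def)
  then have "(\<integral>\<^sup>+ z. (RN_deriv \<omega> \<mu> z)\<^sup>2 \<partial>\<omega>) = (\<integral>\<^sup>+ z. (ennreal (g z))\<^sup>2 \<partial>\<omega>)"
    by (intro nn_integral_cong_AE) auto
  also have "\<dots> \<le> (\<integral>\<^sup>+ z. (ennreal 2)\<^sup>2 \<partial>\<omega>)"
    using g_bounds(2) by (intro nn_integral_mono power_mono ennreal_leI) auto
  also have "\<dots> < \<infinity>" by (simp add: emeasure_space_1 ennreal_power del: ennreal_numeral)
  finally have "\<mu> \<in> L2_star \<omega>"
    unfolding L2_star_def using \<mu>_prob \<mu>_sets ac by simp
  then obtain C where C: "\<And>n. 0 < n \<Longrightarrow> L2_dist \<omega> (\<mu> \<bind> kernel_pow \<omega> K n) \<omega> < ennreal (C * \<rho> ^ n)"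
    using \<rho> unfolding geometric_rates_def by blast
  define h where "h z = f z / N" for z
  have h: "h \<in> bdd_fun \<omega>" unfolding h_def divide_inverse by (intro bdd_fun_closed f)
  have h_mean: "(\<integral>z. h z \<partial>\<omega>) = 0" unfolding h_def using mean by simp
  have "L2_fun_norm \<omega> h = 1"
    using N unfolding h_def L2_fun_norm_def N_def by (simp add: power_divide real_sqrt_divide)
  then have h_in: "h \<in> {f \<in> L2_fun0 \<omega>. L2_fun_norm \<omega> f = 1}"
    using bdd_L2[OF h] h_mean unfolding L2_fun0_def by simp
  have "(\<integral>z. f z * (kernel_op K ^^ n) f z \<partial>\<omega>) \<le> (b * N * C) * \<rho> ^ n" if n: "0 < n" for n
  proof -
    let ?h = "(kernel_op K ^^ n) h" and ?f = "(kernel_op K ^^ n) f"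
    note Kh = kernel_op_pow_bdd[OF h, of n] and Kf = kernel_op_pow_bdd[OF f, of n]
    have "(\<integral>z. h z \<partial>(\<mu> \<bind> kernel_pow \<omega> K n)) = (\<integral>z. ?h z \<partial>\<mu>)"
      by (rule integral_bind_kernel_pow[OF \<mu>_prob \<mu>_sets h])
    also have "\<dots> = (\<integral>z. g z * ?h z \<partial>\<omega>)"
      unfolding \<mu>_def using bdd_fun_measurable[OF Kh] g_bounds by (subst integral_density) auto
    also have "\<dots> = (\<integral>z. ?h z + inverse b * (f z * ?h z) \<partial>\<omega>)"
      unfolding g_def by (intro Bochner_Integration.integral_cong) (auto simp: field_simps)
    also have "\<dots> = inverse b * (\<integral>z. f z * ?h z \<partial>\<omega>)"
      using bdd_integrable[OF Kh] bdd_integrable[OF bdd_fun_mult[OF f Kh]]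
      by (simp add: integral_kernel_op_pow[OF h] h_mean)
    also have "(\<integral>z. f z * ?h z \<partial>\<omega>) = (\<integral>z. ?f z * h z \<partial>\<omega>)"
      by (rule kernel_op_pow_symmetric[OF f h])
    also have "\<dots> = inverse N * (\<integral>z. ?f z * f z \<partial>\<omega>)"
      unfolding h_def by (simp add: field_simps)
    finally have eq: "(\<integral>z. h z \<partial>(\<mu> \<bind> kernel_pow \<omega> K n)) = inverse b * (inverse N * (\<integral>z. f z * ?f z \<partial>\<omega>))"
      by (simp add: mult.commute)
    have "ennreal \<bar>(\<integral>z. h z \<partial>(\<mu> \<bind> kernel_pow \<omega> K n)) - (\<integral>z. h z \<partial>\<omega>)\<bar> < ennreal (C * \<rho> ^ n)"
      using C[OF n] unfolding L2_dist_def by (rule le_less_trans[OF SUP_upper[OF h_in]])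
    then have "\<bar>inverse b * (inverse N * (\<integral>z. f z * ?f z \<partial>\<omega>))\<bar> < C * \<rho> ^ n"
      unfolding eq h_mean by (simp add: ennreal_less_iff)
    then have "inverse b * (inverse N * (\<integral>z. f z * ?f z \<partial>\<omega>)) \<le> C * \<rho> ^ n" by linarith
    then show ?thesis using b(1) N by (simp add: field_simps)
  qed
  then show ?thesis by blast
qed

text \<open>
  By symmetry \<open>\<parallel>K\<^sup>k f\<parallel>\<^sup>2 = \<langle>f, K\<^sup>2\<^sup>k f\<rangle>\<close>, which decays like \<open>\<rho>\<^sup>2\<^sup>k\<close>.  This sequence is log-convex by
  the Cauchy-Schwarz inequality, hence \<open>\<parallel>K f\<parallel> \<le> \<rho> \<parallel>f\<parallel>\<close>.
\<close>

theorem geometric_rate_imp_spectral_bound: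
  assumes \<rho>: "\<rho> \<in> geometric_rates \<omega> K"
    and f: "f \<in> bdd_fun \<omega>" and mean: "(\<integral>z. f z \<partial>\<omega>) = 0"
  shows "(\<integral>z. f z * kernel_op K f z \<partial>\<omega>) \<le> \<rho> * (\<integral>z. (f z)\<^sup>2 \<partial>\<omega>)"
proof -
  let ?T = "\<lambda>k. (kernel_op K ^^ k) f"
  define s where "s k = (\<integral>z. (?T k z)\<^sup>2 \<partial>\<omega>)" for k
  have T: "?T k \<in> bdd_fun \<omega>" for k using f by (rule kernel_op_pow_bdd)
  have \<rho>0: "0 \<le> \<rho>" using \<rho> unfolding geometric_rates_def by simp
  have s_norm: "s k = (L2_fun_norm \<omega> (?T k))\<^sup>2" for k unfolding s_def L2_fun_norm_power2 ..
  obtain D where D: "\<And>n. 0 < n \<Longrightarrow> (\<integral>z. f z * ?T n z \<partial>\<omega>) \<le> D * \<rho> ^ n"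
    using geometric_rate_imp_autocorrelation_decay[OF \<rho> f mean] by blast
  have "s 1 \<le> \<rho>\<^sup>2 * s 0"
  proof (rule ratio_le_of_log_convex)
    show "0 \<le> s k" for k unfolding s_def by simp
    show "0 \<le> \<rho>\<^sup>2" by simp
    show "(s (Suc k))\<^sup>2 \<le> s k * s (Suc (Suc k))" for k
    proof -
      have "s (Suc k) = (\<integral>z. ?T k z * ?T (Suc (Suc k)) z \<partial>\<omega>)"
        unfolding s_def using kernel_op_symmetric[OF T[of k] T[of "Suc k"]] by (simp add: power2_eq_square)
      also have "\<dots> \<le> L2_fun_norm \<omega> (?T k) * L2_fun_norm \<omega> (?T (Suc (Suc k)))"
        using L2_Cauchy_Schwarz[OF bdd_L2[OF T] bdd_L2[OF T]] by (rule order_trans[OF abs_ge_self])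
      finally have "(s (Suc k))\<^sup>2 \<le> (L2_fun_norm \<omega> (?T k) * L2_fun_norm \<omega> (?T (Suc (Suc k))))\<^sup>2"
        by (rule power_mono) (simp add: s_def)
      then show ?thesis by (simp add: s_norm power_mult_distrib)
    qed
    show "s k \<le> D * (\<rho>\<^sup>2) ^ k" if "0 < k" for k
    proof -
      have "s k = (\<integral>z. f z * ?T (k + k) z \<partial>\<omega>)"
        unfolding s_def using kernel_op_pow_symmetric[OF f T[of k], of k]
        by (simp add: power2_eq_square funpow_add)
      also have "\<dots> \<le> D * \<rho> ^ (k + k)" using that by (intro D) simp
      finally show ?thesis by (simp add: power_add power2_eq_square power_mult_distrib)
    qed
  qed
  then have "(L2_fun_norm \<omega> (?T 1))\<^sup>2 \<le> (\<rho> * L2_fun_norm \<omega> f)\<^sup>2"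
    unfolding s_norm by (simp add: power_mult_distrib)
  from power2_le_imp_le[OF this] have le: "L2_fun_norm \<omega> (kernel_op K f) \<le> \<rho> * L2_fun_norm \<omega> f"
    by (simp add: mult_nonneg_nonneg[OF \<rho>0 L2_fun_norm_nonneg])
  have "(\<integral>z. f z * kernel_op K f z \<partial>\<omega>) \<le> L2_fun_norm \<omega> f * L2_fun_norm \<omega> (kernel_op K f)"
    using L2_Cauchy_Schwarz[OF bdd_L2[OF f] bdd_L2[OF kernel_op_bdd[OF f]]] by linarith
  also have "\<dots> \<le> L2_fun_norm \<omega> f * (\<rho> * L2_fun_norm \<omega> f)"
    using le L2_fun_norm_nonneg by (rule mult_left_mono)
  also have "\<dots> = \<rho> * (\<integral>z. (f z)\<^sup>2 \<partial>\<omega>)"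
    unfolding L2_fun_norm_power2[symmetric] by (simp add: power2_eq_square)
  finally show ?thesis .
qed

end

section \<open>Alternating two reversible kernels\<close>

text \<open>
  The kernels \<open>A\<close> and \<open>B\<close> play the roles of \<open>G\<^sub>Y\<close> and \<open>G\<^sub>X\<close> of the introduction.  Split
  \<open>f = h + e\<close> with \<open>e = B f\<close>.  Since \<open>M\<close> is symmetric and fixes \<open>e\<close>, the form \<open>\<langle>f, f - M f\<rangle>\<close>
  equals \<open>\<langle>h, h - M h\<rangle> \<le> 2 \<parallel>h\<parallel>\<^sup>2\<close>, where \<open>\<parallel>h\<parallel>\<^sup>2 = \<parallel>f\<parallel>\<^sup>2 - \<parallel>B f\<parallel>\<^sup>2\<close> because \<open>B\<close> is a projection.
  As \<open>A\<close> fixes \<open>f\<close>, the kernel \<open>R\<close> loses only \<open>r \<langle>f, f - M f\<rangle>\<close> on \<open>f\<close>, and its spectral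
  bound gives the claim.
\<close>

lemma alternating_contraction:
  assumes "reversible_kernel \<omega> B" "reversible_kernel \<omega> M" "reversible_kernel \<omega> R"
    and r: "0 < r"
    and mixture: "\<And>f z. f \<in> bdd_fun \<omega> \<Longrightarrow> z \<in> space \<omega> \<Longrightarrow>
      kernel_op R f z = r * kernel_op M f z + (1 - r) * kernel_op A f z"
    and B_idem: "\<And>f z. f \<in> bdd_fun \<omega> \<Longrightarrow> z \<in> space \<omega> \<Longrightarrow>
      kernel_op B (kernel_op B f) z = kernel_op B f z"
    and M_fixes_B: "\<And>f z. f \<in> bdd_fun \<omega> \<Longrightarrow> z \<in> space \<omega> \<Longrightarrow>
      kernel_op M (kernel_op B f) z = kernel_op B f z"
    and \<rho>: "\<rho> \<in> geometric_rates \<omega> R"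
    and f: "f \<in> bdd_fun \<omega>" "(\<integral>z. f z \<partial>\<omega>) = 0" "\<And>z. z \<in> space \<omega> \<Longrightarrow> kernel_op A f z = f z"
  shows "(\<integral>z. (kernel_op B f z)\<^sup>2 \<partial>\<omega>) \<le> (1 - (1 - \<rho>) / (2 * r)) * (\<integral>z. (f z)\<^sup>2 \<partial>\<omega>)"
proof -
  interpret B: reversible_kernel \<omega> B by fact
  interpret M: reversible_kernel \<omega> M by fact
  interpret R: reversible_kernel \<omega> R by fact
  define e where "e = kernel_op B f"
  define h where "h z = f z - e z" for z
  have e: "e \<in> bdd_fun \<omega>" unfolding e_def by (rule B.kernel_op_bdd[OF f(1)])
  have h: "h \<in> bdd_fun \<omega>" unfolding h_def by (intro bdd_fun_closed e f)
  note Mf = M.kernel_op_bdd[OF f(1)] and Mh = M.kernel_op_bdd[OF h]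
  note int = B.bdd_integrable[OF bdd_fun_mult]
  have M_e: "kernel_op M e z = e z" if "z \<in> space \<omega>" for z
    unfolding e_def using f(1) that by (rule M_fixes_B)
  have ee: "(\<integral>z. (e z)\<^sup>2 \<partial>\<omega>) = (\<integral>z. f z * e z \<partial>\<omega>)"
  proof -
    have "(\<integral>z. f z * e z \<partial>\<omega>) = (\<integral>z. f z * kernel_op B e z \<partial>\<omega>)"
      by (intro Bochner_Integration.integral_cong) (auto simp: e_def B_idem[OF f(1)])
    also have "\<dots> = (\<integral>z. e z * e z \<partial>\<omega>)"
      unfolding B.kernel_op_symmetric[OF f(1) e] by (simp add: e_def)
    finally show ?thesis by (simp add: power2_eq_square)
  qed
  have hh: "(\<integral>z. (h z)\<^sup>2 \<partial>\<omega>) = (\<integral>z. (f z)\<^sup>2 \<partial>\<omega>) - (\<integral>z. (e z)\<^sup>2 \<partial>\<omega>)"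
  proof -
    have "(\<integral>z. (h z)\<^sup>2 \<partial>\<omega>) = (\<integral>z. f z * f z - 2 * (f z * e z) + e z * e z \<partial>\<omega>)"
      unfolding h_def by (intro Bochner_Integration.integral_cong) (auto simp: power2_eq_square algebra_simps)
    also have "\<dots> = (\<integral>z. f z * f z \<partial>\<omega>) - 2 * (\<integral>z. f z * e z \<partial>\<omega>) + (\<integral>z. e z * e z \<partial>\<omega>)"
      using int[OF f(1) f(1)] int[OF f(1) e] int[OF e e] by simp
    finally show ?thesis using ee by (simp add: power2_eq_square)
  qed
  have dirichlet: "(\<integral>z. f z * (f z - kernel_op M f z) \<partial>\<omega>) \<le> 2 * (\<integral>z. (h z)\<^sup>2 \<partial>\<omega>)"
  proof -
    have "(\<integral>z. f z * (f z - kernel_op M f z) \<partial>\<omega>) =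
        (\<integral>z. h z * h z - h z * kernel_op M h z + (e z * h z - e z * kernel_op M h z) \<partial>\<omega>)"
    proof (intro Bochner_Integration.integral_cong refl)
      fix z assume z: "z \<in> space \<omega>"
      have "kernel_op M h z = kernel_op M f z - e z"
        unfolding h_def M.kernel_op_diff[OF f(1) e z] M_e[OF z] ..
      then have "kernel_op M f z = kernel_op M h z + e z" by simp
      then show "f z * (f z - kernel_op M f z) =
          h z * h z - h z * kernel_op M h z + (e z * h z - e z * kernel_op M h z)"
        by (simp add: h_def algebra_simps)
    qed
    also have "\<dots> = (\<integral>z. h z * h z \<partial>\<omega>) - (\<integral>z. h z * kernel_op M h z \<partial>\<omega>) +
        ((\<integral>z. e z * h z \<partial>\<omega>) - (\<integral>z. e z * kernel_op M h z \<partial>\<omega>))"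
      using int[OF h h] int[OF h Mh] int[OF e h] int[OF e Mh] by simp
    also have "(\<integral>z. e z * kernel_op M h z \<partial>\<omega>) = (\<integral>z. e z * h z \<partial>\<omega>)"
      unfolding M.kernel_op_symmetric[OF e h]
      by (intro Bochner_Integration.integral_cong) (auto simp: M_e)
    finally have "(\<integral>z. f z * (f z - kernel_op M f z) \<partial>\<omega>) =
        (\<integral>z. h z * h z \<partial>\<omega>) - (\<integral>z. h z * kernel_op M h z \<partial>\<omega>)" by simp
    moreover have "- (\<integral>z. h z * kernel_op M h z \<partial>\<omega>) \<le> L2_fun_norm \<omega> h * L2_fun_norm \<omega> h"
      using L2_Cauchy_Schwarz[OF B.bdd_L2[OF h] B.bdd_L2[OF Mh]]
        mult_left_mono[OF M.kernel_op_norm_le[OF h] L2_fun_norm_nonneg[of \<omega> h]] by linarith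
    moreover have "L2_fun_norm \<omega> h * L2_fun_norm \<omega> h = (\<integral>z. (h z)\<^sup>2 \<partial>\<omega>)"
      unfolding L2_fun_norm_power2[symmetric] by (simp add: power2_eq_square)
    ultimately show ?thesis unfolding power2_eq_square by linarith
  qed
  have "(\<integral>z. f z * (f z - kernel_op M f z) \<partial>\<omega>) = (\<integral>z. f z * f z \<partial>\<omega>) - (\<integral>z. f z * kernel_op M f z \<partial>\<omega>)"
    using int[OF f(1) f(1)] int[OF f(1) Mf] by (simp add: right_diff_distrib)
  then have "r * (\<integral>z. f z * (f z - kernel_op M f z) \<partial>\<omega>) =
      r * (\<integral>z. f z * f z \<partial>\<omega>) - r * (\<integral>z. f z * kernel_op M f z \<partial>\<omega>)"
    by (simp only: right_diff_distrib)
  moreover have "(\<integral>z. f z * kernel_op R f z \<partial>\<omega>) =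
      (\<integral>z. r * (f z * kernel_op M f z) + (1 - r) * (f z * f z) \<partial>\<omega>)"
    by (intro Bochner_Integration.integral_cong) (auto simp: mixture[OF f(1)] f(3) algebra_simps)
  then have "(\<integral>z. f z * kernel_op R f z \<partial>\<omega>) =
      r * (\<integral>z. f z * kernel_op M f z \<partial>\<omega>) + (1 - r) * (\<integral>z. f z * f z \<partial>\<omega>)"
    using int[OF f(1) f(1)] int[OF f(1) Mf] by simp
  ultimately have "(\<integral>z. (f z)\<^sup>2 \<partial>\<omega>) - (\<integral>z. f z * kernel_op R f z \<partial>\<omega>) =
      r * (\<integral>z. f z * (f z - kernel_op M f z) \<partial>\<omega>)"
    unfolding power2_eq_square left_diff_distrib by linarith
  also have "\<dots> \<le> r * (2 * (\<integral>z. (h z)\<^sup>2 \<partial>\<omega>))"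
    using dirichlet r by (intro mult_left_mono) auto
  finally have "(1 - \<rho>) * (\<integral>z. (f z)\<^sup>2 \<partial>\<omega>) \<le> 2 * r * ((\<integral>z. (f z)\<^sup>2 \<partial>\<omega>) - (\<integral>z. (e z)\<^sup>2 \<partial>\<omega>))"
    using R.geometric_rate_imp_spectral_bound[OF \<rho> f(1,2)] hh by (simp add: algebra_simps)
  then have "(1 - \<rho>) * (\<integral>z. (f z)\<^sup>2 \<partial>\<omega>) / (2 * r) \<le> (\<integral>z. (f z)\<^sup>2 \<partial>\<omega>) - (\<integral>z. (e z)\<^sup>2 \<partial>\<omega>)"
    using r by (simp add: pos_divide_le_eq mult.commute)
  then show ?thesis unfolding e_def by (simp add: left_diff_distrib)
qed

text \<open>
  One step of \<open>D\<close> lands in the range of \<open>A\<close>, on which \<open>B\<close> contracts.  The first step may fail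
  to contract, which costs a constant factor only.
\<close>

lemma alternating_rate_less_one:
  assumes "markov_kernel \<omega> D" "reversible_kernel \<omega> A" "reversible_kernel \<omega> B"
    and D: "\<And>f z. f \<in> bdd_fun \<omega> \<Longrightarrow> z \<in> space \<omega> \<Longrightarrow> kernel_op D f z = kernel_op A (kernel_op B f) z"
    and A_idem: "\<And>f z. f \<in> bdd_fun \<omega> \<Longrightarrow> z \<in> space \<omega> \<Longrightarrow>
      kernel_op A (kernel_op A f) z = kernel_op A f z"
    and c: "c < 1"
    and contr: "\<And>f. f \<in> bdd_fun \<omega> \<Longrightarrow> (\<integral>z. f z \<partial>\<omega>) = 0 \<Longrightarrow>
      (\<And>z. z \<in> space \<omega> \<Longrightarrow> kernel_op A f z = f z) \<Longrightarrow>
      (\<integral>z. (kernel_op B f z)\<^sup>2 \<partial>\<omega>) \<le> c * (\<integral>z. (f z)\<^sup>2 \<partial>\<omega>)"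
  shows "L2_rate \<omega> D < 1"
proof -
  interpret D: markov_kernel \<omega> D by fact
  interpret A: reversible_kernel \<omega> A by fact
  interpret B: reversible_kernel \<omega> B by fact
  \<comment> \<open>\<open>1 / 4\<close> stands for any positive number below \<open>1\<close>: the rate must be positive, but \<open>c\<close> need not be\<close>
  define \<kappa> where "\<kappa> = sqrt (max c (1 / 4))"
  have \<kappa>: "0 < \<kappa>" "\<kappa> < 1" "c \<le> \<kappa>\<^sup>2" unfolding \<kappa>_def using c by auto
  have norm_D: "L2_fun_norm \<omega> (kernel_op D f) = L2_fun_norm \<omega> (kernel_op A (kernel_op B f))"
    if "f \<in> bdd_fun \<omega>" for f
    unfolding L2_fun_norm_def
    by (intro arg_cong[where f=sqrt] Bochner_Integration.integral_cong) (simp_all only: D[OF that])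
  have norm_D_le: "L2_fun_norm \<omega> (kernel_op D f) \<le> L2_fun_norm \<omega> (kernel_op B f)" if "f \<in> bdd_fun \<omega>" for f
    unfolding norm_D[OF that] by (rule A.kernel_op_norm_le[OF B.kernel_op_bdd[OF that]])
  have mean_D: "(\<integral>z. kernel_op D f z \<partial>\<omega>) = (\<integral>z. f z \<partial>\<omega>)" if "f \<in> bdd_fun \<omega>" for f
  proof -
    have "(\<integral>z. kernel_op D f z \<partial>\<omega>) = (\<integral>z. kernel_op A (kernel_op B f) z \<partial>\<omega>)"
      by (intro Bochner_Integration.integral_cong) (simp_all only: D[OF that])
    then show ?thesis
      using A.integral_kernel_op[OF B.kernel_op_bdd[OF that]] B.integral_kernel_op[OF that] by argo
  qed
  have fixed: "kernel_op A (kernel_op D f) z = kernel_op D f z"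
    if "f \<in> bdd_fun \<omega>" "z \<in> space \<omega>" for f z
  proof -
    have "kernel_op A (kernel_op D f) z = kernel_op A (kernel_op A (kernel_op B f)) z"
      using that by (intro A.kernel_op_cong D)
    then show ?thesis using A_idem[OF B.kernel_op_bdd[OF that(1)] that(2)] D[OF that] by argo
  qed
  have bound: "L2_fun_norm \<omega> ((kernel_op D ^^ Suc n) f) \<le> \<kappa> ^ n * L2_fun_norm \<omega> f \<and>
      (\<integral>z. (kernel_op D ^^ Suc n) f z \<partial>\<omega>) = 0"
    if f: "f \<in> bdd_fun \<omega>" "(\<integral>z. f z \<partial>\<omega>) = 0" for n f
  proof (induction n)
    case 0
    have "L2_fun_norm \<omega> (kernel_op D f) \<le> L2_fun_norm \<omega> f"
      using norm_D_le[OF f(1)] B.kernel_op_norm_le[OF f(1)] by linarith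
    then show ?case using mean_D[OF f(1)] f(2) by simp
  next
    case (Suc n)
    define g where "g = (kernel_op D ^^ Suc n) f"
    have g: "g \<in> bdd_fun \<omega>" unfolding g_def by (rule D.kernel_op_pow_bdd[OF f(1)])
    have "kernel_op A g z = g z" if "z \<in> space \<omega>" for z
      unfolding g_def using fixed[OF D.kernel_op_pow_bdd[OF f(1), of n] that] by simp
    with Suc have "(\<integral>z. (kernel_op B g z)\<^sup>2 \<partial>\<omega>) \<le> c * (\<integral>z. (g z)\<^sup>2 \<partial>\<omega>)"
      unfolding g_def[symmetric] by (intro contr g) auto
    also have "\<dots> \<le> \<kappa>\<^sup>2 * (\<integral>z. (g z)\<^sup>2 \<partial>\<omega>)" using \<kappa>(3) by (intro mult_right_mono) auto
    finally have "(L2_fun_norm \<omega> (kernel_op B g))\<^sup>2 \<le> (\<kappa> * L2_fun_norm \<omega> g)\<^sup>2"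
      by (simp add: L2_fun_norm_power2 power_mult_distrib)
    then have "L2_fun_norm \<omega> (kernel_op B g) \<le> \<kappa> * L2_fun_norm \<omega> g"
      by (rule power2_le_imp_le) (rule mult_nonneg_nonneg[OF less_imp_le[OF \<kappa>(1)] L2_fun_norm_nonneg])
    also have "\<dots> \<le> \<kappa> * (\<kappa> ^ n * L2_fun_norm \<omega> f)"
      using Suc \<kappa> unfolding g_def by (intro mult_left_mono) auto
    finally have "L2_fun_norm \<omega> (kernel_op D g) \<le> \<kappa> ^ Suc n * L2_fun_norm \<omega> f"
      using norm_D_le[OF g] by simp
    then show ?case using mean_D[OF g] Suc unfolding g_def by simp
  qed
  have "\<kappa> \<in> geometric_rates \<omega> D"
  proof (rule D.geometric_ratesI)
    fix n f assume "0 < (n::nat)" "f \<in> bdd_fun \<omega>" "(\<integral>z. f z \<partial>\<omega>) = 0"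
    then show "L2_fun_norm \<omega> ((kernel_op D ^^ n) f) \<le> inverse \<kappa> * \<kappa> ^ n * L2_fun_norm \<omega> f"
      using bound[of f "n - 1"] \<kappa>(1) by (cases n) (auto simp: mult.assoc[symmetric])
  qed (use \<kappa> in auto)
  then have "L2_rate \<omega> D \<le> \<kappa>" by (rule L2_rate_le)
  with \<kappa>(2) show ?thesis by linarith
qed

section \<open>Mixtures of measures and of kernels\<close>

text \<open>
  The Metropolis-Hastings kernel and the random-scan kernel are given by their values on sets as
  combinations of two measures.  This shows that such a set function is a measure and how it
  integrates.
\<close>

lemma mixture_measure:
  assumes sets: "sets M1 = sets M" "sets M2 = sets M"
    and N: "N = measure_of (space M) (sets M) \<phi>"
    and \<phi>: "\<And>A. A \<in> sets M \<Longrightarrow> \<phi> A = a * emeasure M1 A + b * emeasure M2 A"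
  shows mixture_emeasure: "A \<in> sets M \<Longrightarrow> emeasure N A = a * emeasure M1 A + b * emeasure M2 A"
    and mixture_nn_integral: "f \<in> borel_measurable M \<Longrightarrow>
      (\<integral>\<^sup>+ z. f z \<partial>N) = a * (\<integral>\<^sup>+ z. f z \<partial>M1) + b * (\<integral>\<^sup>+ z. f z \<partial>M2)"
proof -
  have sets_N: "sets N = sets M" unfolding N by simp
  have space_eq: "space N = space M" "space M1 = space M" "space M2 = space M"
    using sets sets_N by (auto dest: sets_eq_imp_space_eq)
  have emeasure_N: "emeasure N A = a * emeasure M1 A + b * emeasure M2 A" if "A \<in> sets M" for A
  proof -
    have "positive (sets N) \<phi>"
      unfolding positive_def sets_N by (simp add: \<phi>)
    moreover have "countably_additive (sets N) \<phi>"
    proof (rule countably_additiveI)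
      fix B :: "nat \<Rightarrow> _"
      assume B: "range B \<subseteq> sets N" "disjoint_family B" "(\<Union>i. B i) \<in> sets N"
      then have "(\<Sum>i. \<phi> (B i)) = (\<Sum>i. a * emeasure M1 (B i) + b * emeasure M2 (B i))"
        unfolding sets_N by (intro suminf_cong \<phi>) auto
      also have "\<dots> = (\<Sum>i. a * emeasure M1 (B i)) + (\<Sum>i. b * emeasure M2 (B i))"
        by (intro suminf_add[symmetric]) auto
      also have "\<dots> = a * emeasure M1 (\<Union>i. B i) + b * emeasure M2 (\<Union>i. B i)"
        using B sets sets_N by (simp add: suminf_emeasure)
      also have "\<dots> = \<phi> (\<Union>i. B i)" using B sets_N by (simp add: \<phi>)
      finally show "(\<Sum>i. \<phi> (B i)) = \<phi> (\<Union>i. B i)" .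
    qed
    ultimately have "emeasure N A = \<phi> A"
      using that sets_N by (intro emeasure_measure_of[OF N sets.space_closed]) auto
    then show ?thesis using \<phi>[OF that] by simp
  qed
  then show "A \<in> sets M \<Longrightarrow> emeasure N A = a * emeasure M1 A + b * emeasure M2 A" .
  note [measurable_cong] = sets sets_N
  show "(\<integral>\<^sup>+ z. f z \<partial>N) = a * (\<integral>\<^sup>+ z. f z \<partial>M1) + b * (\<integral>\<^sup>+ z. f z \<partial>M2)"
    if "f \<in> borel_measurable M"
    using that
  proof (induction rule: borel_measurable_induct)
    case (cong f g)
    then have "(\<integral>\<^sup>+ z. g z \<partial>L) = (\<integral>\<^sup>+ z. f z \<partial>L)" if "space L = space M" for L
      using that by (intro nn_integral_cong) simp
    then show ?case using cong space_eq by simp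
  next
    case (set A)
    then show ?case using sets sets_N by (simp add: emeasure_N)
  next
    case (mult u c)
    note [measurable] = mult(1,2)
    show ?case using mult by (simp add: nn_integral_cmult distrib_left mult.left_commute)
  next
    case (add u v)
    note [measurable] = add(1,3)
    show ?case using add by (simp add: nn_integral_add distrib_left ac_simps)
  next
    case (seq U)
    note [measurable] = seq(1)
    have SUP: "(\<integral>\<^sup>+ z. (SUP i. U i z) \<partial>L) = (SUP i. \<integral>\<^sup>+ z. U i z \<partial>L)" if "sets L = sets M" for L
    proof -
      note [measurable_cong] = that
      show ?thesis by (rule nn_integral_monotone_convergence_SUP[OF seq(3)]) measurable
    qed
    have inc: "incseq (\<lambda>i. \<integral>\<^sup>+ z. U i z \<partial>L)" for L
      using seq(3) by (auto simp: incseq_def le_fun_def intro!: nn_integral_mono)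
    have inc': "incseq (\<lambda>i. c * (\<integral>\<^sup>+ z. U i z \<partial>L))" for c L
      using inc[of L] by (auto simp: incseq_def intro!: mult_left_mono)
    have "(\<integral>\<^sup>+ z. (SUP i. U i z) \<partial>N) = (SUP i. a * (\<integral>\<^sup>+ z. U i z \<partial>M1) + b * (\<integral>\<^sup>+ z. U i z \<partial>M2))"
      using seq by (simp add: SUP[OF sets_N])
    also have "\<dots> = a * (SUP i. \<integral>\<^sup>+ z. U i z \<partial>M1) + b * (SUP i. \<integral>\<^sup>+ z. U i z \<partial>M2)"
      by (simp add: ennreal_SUP_add[OF inc' inc'] SUP_mult_left_ennreal)
    finally show ?case by (simp add: SUP[OF sets(1)] SUP[OF sets(2)] image_comp)
  qed
qed

lemma mixture_kernel_reversible:
  assumes M: "reversible_kernel \<omega> M" and L: "reversible_kernel \<omega> L" and r: "0 \<le> r" "r \<le> 1"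
    and R: "\<And>z. z \<in> space \<omega> \<Longrightarrow> R z = measure_of (space \<omega>) (sets \<omega>)
      (\<lambda>E. ennreal r * emeasure (M z) E + ennreal (1 - r) * emeasure (L z) E)"
  shows "reversible_kernel \<omega> R"
    and "f \<in> bdd_fun \<omega> \<Longrightarrow> z \<in> space \<omega> \<Longrightarrow>
      kernel_op R f z = r * kernel_op M f z + (1 - r) * kernel_op L f z"
proof -
  interpret M: reversible_kernel \<omega> M by fact
  interpret L: reversible_kernel \<omega> L by fact
  have r1: "ennreal r + ennreal (1 - r) = 1" using r by (simp flip: ennreal_plus)
  have emeasure_R: "emeasure (R z) E = ennreal r * emeasure (M z) E + ennreal (1 - r) * emeasure (L z) E"
    if "z \<in> space \<omega>" "E \<in> sets \<omega>" for z E
    by (rule mixture_emeasure[OF M.sets_kernel_eq[OF that(1)] L.sets_kernel_eq[OF that(1)] R[OF that(1)] refl that(2)])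
  have nn_R: "(\<integral>\<^sup>+ w. f w \<partial>R z) = ennreal r * (\<integral>\<^sup>+ w. f w \<partial>M z) + ennreal (1 - r) * (\<integral>\<^sup>+ w. f w \<partial>L z)"
    if "z \<in> space \<omega>" "f \<in> borel_measurable \<omega>" for z f
    by (rule mixture_nn_integral[OF M.sets_kernel_eq[OF that(1)] L.sets_kernel_eq[OF that(1)] R[OF that(1)] refl that(2)])
  have sets_R: "sets (R z) = sets \<omega>" if "z \<in> space \<omega>" for z using R[OF that] by simp
  have prob_R: "prob_space (R z)" if z: "z \<in> space \<omega>" for z
  proof
    have "space (R z) = space \<omega>" "space (M z) = space \<omega>" "space (L z) = space \<omega>"
      using sets_R[OF z] M.sets_kernel_eq[OF z] L.sets_kernel_eq[OF z] by (auto dest: sets_eq_imp_space_eq)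
    then show "emeasure (R z) (space (R z)) = 1"
      using emeasure_R[OF z, of "space \<omega>"] r1 prob_space.emeasure_space_1[OF M.prob_space_kernel[OF z]]
        prob_space.emeasure_space_1[OF L.prob_space_kernel[OF z]] by simp
  qed
  have kernel_R: "R \<in> \<omega> \<rightarrow>\<^sub>M prob_algebra \<omega>"
  proof (intro measurable_prob_algebraI measurable_subprob_algebra)
    fix E assume [measurable]: "E \<in> sets \<omega>"
    note [measurable] = measurable_prob_algebraD[OF M.kernel] measurable_prob_algebraD[OF L.kernel]
    have "(\<lambda>z. ennreal r * emeasure (M z) E + ennreal (1 - r) * emeasure (L z) E) \<in> borel_measurable \<omega>"
      by measurable
    then show "(\<lambda>z. emeasure (R z) E) \<in> borel_measurable \<omega>"
      by (subst measurable_cong[OF emeasure_R]) auto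
  qed (auto simp: prob_R sets_R prob_space_imp_subprob_space)
  show "reversible_kernel \<omega> R"
  proof (unfold_locales, rule kernel_R)
    fix f g :: "_ \<Rightarrow> ennreal" assume [measurable]: "f \<in> borel_measurable \<omega>" "g \<in> borel_measurable \<omega>"
    have nn_meas: "(\<lambda>z. \<integral>\<^sup>+ w. v w \<partial>N z) \<in> borel_measurable \<omega>"
      if "N \<in> \<omega> \<rightarrow>\<^sub>M prob_algebra \<omega>" "v \<in> borel_measurable \<omega>" for N and v :: "_ \<Rightarrow> ennreal"
      using measurable_compose[OF measurable_prob_algebraD[OF that(1)]
        nn_integral_measurable_subprob_algebra[OF that(2)]] .
    have split: "(\<integral>\<^sup>+ z. u z * (\<integral>\<^sup>+ w. v w \<partial>R z) \<partial>\<omega>) =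
        ennreal r * (\<integral>\<^sup>+ z. u z * (\<integral>\<^sup>+ w. v w \<partial>M z) \<partial>\<omega>) +
        ennreal (1 - r) * (\<integral>\<^sup>+ z. u z * (\<integral>\<^sup>+ w. v w \<partial>L z) \<partial>\<omega>)"
      if [measurable]: "u \<in> borel_measurable \<omega>" "v \<in> borel_measurable \<omega>" for u v
    proof -
      note [measurable] = nn_meas[OF M.kernel that(2)] nn_meas[OF L.kernel that(2)]
      have "(\<integral>\<^sup>+ z. u z * (\<integral>\<^sup>+ w. v w \<partial>R z) \<partial>\<omega>) =
          (\<integral>\<^sup>+ z. ennreal r * (u z * (\<integral>\<^sup>+ w. v w \<partial>M z)) + ennreal (1 - r) * (u z * (\<integral>\<^sup>+ w. v w \<partial>L z)) \<partial>\<omega>)"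
        by (intro nn_integral_cong) (simp add: nn_R distrib_left mult.left_commute)
      also have "\<dots> = (\<integral>\<^sup>+ z. ennreal r * (u z * (\<integral>\<^sup>+ w. v w \<partial>M z)) \<partial>\<omega>) +
          (\<integral>\<^sup>+ z. ennreal (1 - r) * (u z * (\<integral>\<^sup>+ w. v w \<partial>L z)) \<partial>\<omega>)"
        by (rule nn_integral_add) measurable
      finally show ?thesis by (simp add: nn_integral_cmult)
    qed
    show "(\<integral>\<^sup>+ z. f z * (\<integral>\<^sup>+ w. g w \<partial>R z) \<partial>\<omega>) = (\<integral>\<^sup>+ z. g z * (\<integral>\<^sup>+ w. f w \<partial>R z) \<partial>\<omega>)"
      using M.reversible[of f g] L.reversible[of f g] by (simp add: split)
  qed
  show "kernel_op R f z = r * kernel_op M f z + (1 - r) * kernel_op L f z"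
    if f: "f \<in> bdd_fun \<omega>" and z: "z \<in> space \<omega>"
  proof -
    obtain b where b: "0 < b" "\<And>z. z \<in> space \<omega> \<Longrightarrow> \<bar>f z\<bar> \<le> b" by (rule bdd_funE[OF f]) blast
    have pos: "0 \<le> f w + b" if "w \<in> space \<omega>" for w using b(2)[OF that] by linarith
    note [measurable] = bdd_fun_measurable[OF f]
    have shift: "(\<integral>\<^sup>+ w. ennreal (f w + b) \<partial>N) = ennreal ((\<integral>w. f w \<partial>N) + b)" "0 \<le> (\<integral>w. f w \<partial>N) + b"
      if "prob_space N" "sets N = sets \<omega>" for N
      using prob_space.shifted_nn_integral[OF that f, of b] pos sets_eq_imp_space_eq[OF that(2)] by auto
    note sR = shift[OF prob_R[OF z] sets_R[OF z]]
      and sM = shift[OF M.prob_space_kernel[OF z] M.sets_kernel_eq[OF z]]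
      and sL = shift[OF L.prob_space_kernel[OF z] L.sets_kernel_eq[OF z]]
    have "ennreal ((\<integral>w. f w \<partial>R z) + b) =
        ennreal r * ennreal ((\<integral>w. f w \<partial>M z) + b) + ennreal (1 - r) * ennreal ((\<integral>w. f w \<partial>L z) + b)"
      using nn_R[OF z, of "\<lambda>w. ennreal (f w + b)"] by (simp add: sR sM sL)
    also have "\<dots> = ennreal (r * ((\<integral>w. f w \<partial>M z) + b) + (1 - r) * ((\<integral>w. f w \<partial>L z) + b))"
      using r sM(2) sL(2) by (simp add: ennreal_mult ennreal_plus)
    finally have "(\<integral>w. f w \<partial>R z) + b = r * ((\<integral>w. f w \<partial>M z) + b) + (1 - r) * ((\<integral>w. f w \<partial>L z) + b)"
      using r sR(2) sM(2) sL(2) by (subst (asm) ennreal_inj) auto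
    then show ?thesis unfolding kernel_op_def by (simp add: algebra_simps)
  qed
qed

section \<open>Moves inside the fibres of a disintegrated measure\<close>

text \<open>
  A measure \<open>\<omega>\<close> disintegrated along \<open>\<pi>\<close>: the fibre over \<open>s\<close> is parametrised by \<open>e s\<close> and carries
  the conditional distribution \<open>c s\<close>.  With \<open>\<omega> = \<Pi>\<close> it describes an update of either coordinate:
  \<open>\<pi>\<close> is the coordinate that is kept, and \<open>F\<close> is the space of the other one.
\<close>

locale fibred_measure = prob_space \<omega> for \<omega> :: "'z measure" +
  fixes S :: "'s measure" and F :: "'w measure"
    and \<pi> :: "'z \<Rightarrow> 's" and e :: "'s \<Rightarrow> 'w \<Rightarrow> 'z" and c :: "'s \<Rightarrow> 'w measure"
  assumes proj_measurable [measurable]: "\<pi> \<in> \<omega> \<rightarrow>\<^sub>M S"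
    and embed_measurable: "(\<lambda>(s, w). e s w) \<in> S \<Otimes>\<^sub>M F \<rightarrow>\<^sub>M \<omega>"
    and proj_embed: "\<And>s w. s \<in> space S \<Longrightarrow> w \<in> space F \<Longrightarrow> \<pi> (e s w) = s"
    and cond_kernel: "c \<in> S \<rightarrow>\<^sub>M prob_algebra F"
    and disintegration: "\<omega> = distr \<omega> S \<pi> \<bind> (\<lambda>s. distr (c s) \<omega> (e s))"
begin

definition fibre_move :: "('z \<Rightarrow> 'w measure) \<Rightarrow> 'z \<Rightarrow> 'z measure" where
  "fibre_move k z = distr (k z) \<omega> (e (\<pi> z))"

definition gibbs :: "'z \<Rightarrow> 'z measure" where
  "gibbs = fibre_move (\<lambda>z. c (\<pi> z))"

lemma embed_measurable_fibre: "s \<in> space S \<Longrightarrow> e s \<in> F \<rightarrow>\<^sub>M \<omega>"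
  using measurable_compose[OF measurable_Pair1' embed_measurable, of s] by simp

lemma proj_space: "z \<in> space \<omega> \<Longrightarrow> \<pi> z \<in> space S"
  using proj_measurable by (rule measurable_space)

lemma sets_cond: "s \<in> space S \<Longrightarrow> sets (c s) = sets F"
  and space_cond: "s \<in> space S \<Longrightarrow> space (c s) = space F"
  using measurable_space[OF cond_kernel, of s] by (auto simp: space_prob_algebra dest: sets_eq_imp_space_eq)

lemma nn_integral_disintegrate:
  assumes [measurable]: "f \<in> borel_measurable \<omega>"
  shows "(\<integral>\<^sup>+ z. f z \<partial>\<omega>) = (\<integral>\<^sup>+ s. \<integral>\<^sup>+ w. f (e s w) \<partial>c s \<partial>distr \<omega> S \<pi>)"
proof -
  have "(\<lambda>s. distr (c s) \<omega> (e s)) \<in> S \<rightarrow>\<^sub>M prob_algebra \<omega>"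
    using cond_kernel embed_measurable by (rule measurable_distr_prob_space2)
  then have J: "(\<lambda>s. distr (c s) \<omega> (e s)) \<in> distr \<omega> S \<pi> \<rightarrow>\<^sub>M subprob_algebra \<omega>"
    using measurable_prob_algebraD by (simp cong: measurable_cong_sets)
  have "(\<integral>\<^sup>+ z. f z \<partial>\<omega>) = (\<integral>\<^sup>+ s. \<integral>\<^sup>+ z. f z \<partial>distr (c s) \<omega> (e s) \<partial>distr \<omega> S \<pi>)"
    by (subst disintegration, rule nn_integral_bind[OF _ J]) measurable
  also have "\<dots> = (\<integral>\<^sup>+ s. \<integral>\<^sup>+ w. f (e s w) \<partial>c s \<partial>distr \<omega> S \<pi>)"
    using embed_measurable_fibre sets_cond
    by (intro nn_integral_cong nn_integral_distr) (auto cong: measurable_cong_sets)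
  finally show ?thesis .
qed

lemma fibre_move_kernel:
  assumes "k \<in> \<omega> \<rightarrow>\<^sub>M prob_algebra F"
  shows "fibre_move k \<in> \<omega> \<rightarrow>\<^sub>M prob_algebra \<omega>"
  unfolding fibre_move_def
proof (rule measurable_distr_prob_space2[OF assms])
  have "(\<lambda>p. (\<pi> (fst p), snd p)) \<in> \<omega> \<Otimes>\<^sub>M F \<rightarrow>\<^sub>M S \<Otimes>\<^sub>M F" by measurable
  from measurable_compose[OF this embed_measurable]
  show "(\<lambda>(z, w). e (\<pi> z) w) \<in> \<omega> \<Otimes>\<^sub>M F \<rightarrow>\<^sub>M \<omega>" by (simp add: case_prod_beta')
qed

lemma nn_integral_fibre_move:
  assumes "k \<in> \<omega> \<rightarrow>\<^sub>M prob_algebra F" "f \<in> borel_measurable \<omega>" "z \<in> space \<omega>"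
  shows "(\<integral>\<^sup>+ z'. f z' \<partial>fibre_move k z) = (\<integral>\<^sup>+ w. f (e (\<pi> z) w) \<partial>k z)"
proof -
  have "sets (k z) = sets F" using measurable_space[OF assms(1,3)] by (simp add: space_prob_algebra)
  then show ?thesis unfolding fibre_move_def
    using embed_measurable_fibre[OF proj_space[OF assms(3)]] assms(2)
    by (intro nn_integral_distr) (auto cong: measurable_cong_sets)
qed

lemma kernel_op_fibre_move:
  assumes "k \<in> \<omega> \<rightarrow>\<^sub>M prob_algebra F" "f \<in> borel_measurable \<omega>" "z \<in> space \<omega>"
  shows "kernel_op (fibre_move k) f z = (\<integral>w. f (e (\<pi> z) w) \<partial>k z)"
proof -
  have "sets (k z) = sets F" using measurable_space[OF assms(1,3)] by (simp add: space_prob_algebra)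
  then show ?thesis unfolding fibre_move_def kernel_op_def
    using embed_measurable_fibre[OF proj_space[OF assms(3)]] assms(2)
    by (intro integral_distr) (auto cong: measurable_cong_sets)
qed

text \<open>
  Reversibility can be checked in each fibre separately, since the move does not leave it.
\<close>

lemma fibre_move_reversible:
  assumes k: "k \<in> \<omega> \<rightarrow>\<^sub>M prob_algebra F"
    and detailed_balance: "\<And>s f g. s \<in> space S \<Longrightarrow> f \<in> borel_measurable F \<Longrightarrow> g \<in> borel_measurable F \<Longrightarrow>
      (\<integral>\<^sup>+ w. f w * (\<integral>\<^sup>+ w'. g w' \<partial>k (e s w)) \<partial>c s) = (\<integral>\<^sup>+ w. g w * (\<integral>\<^sup>+ w'. f w' \<partial>k (e s w)) \<partial>c s)"
  shows "reversible_kernel \<omega> (fibre_move k)"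
proof (unfold_locales, rule fibre_move_kernel[OF k])
  fix f g :: "'z \<Rightarrow> ennreal" assume f: "f \<in> borel_measurable \<omega>" and g: "g \<in> borel_measurable \<omega>"
  have fibrewise: "(\<integral>\<^sup>+ z. u z * (\<integral>\<^sup>+ z'. v z' \<partial>fibre_move k z) \<partial>\<omega>) =
      (\<integral>\<^sup>+ s. \<integral>\<^sup>+ w. u (e s w) * (\<integral>\<^sup>+ w'. v (e s w') \<partial>k (e s w)) \<partial>c s \<partial>distr \<omega> S \<pi>)"
    if u: "u \<in> borel_measurable \<omega>" and v: "v \<in> borel_measurable \<omega>" for u v :: "'z \<Rightarrow> ennreal"
  proof -
    have [measurable]: "(\<lambda>z. \<integral>\<^sup>+ z'. v z' \<partial>fibre_move k z) \<in> borel_measurable \<omega>"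
      using measurable_compose[OF measurable_prob_algebraD[OF fibre_move_kernel[OF k]]
        nn_integral_measurable_subprob_algebra[OF v]] .
    have "(\<integral>\<^sup>+ z. u z * (\<integral>\<^sup>+ z'. v z' \<partial>fibre_move k z) \<partial>\<omega>) =
        (\<integral>\<^sup>+ s. \<integral>\<^sup>+ w. u (e s w) * (\<integral>\<^sup>+ z'. v z' \<partial>fibre_move k (e s w)) \<partial>c s \<partial>distr \<omega> S \<pi>)"
      by (rule nn_integral_disintegrate) (use u in measurable)
    also have "\<dots> = (\<integral>\<^sup>+ s. \<integral>\<^sup>+ w. u (e s w) * (\<integral>\<^sup>+ w'. v (e s w') \<partial>k (e s w)) \<partial>c s \<partial>distr \<omega> S \<pi>)"
    proof (intro nn_integral_cong)
      fix s w assume s: "s \<in> space (distr \<omega> S \<pi>)" and "w \<in> space (c s)"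
      then have s: "s \<in> space S" and w: "w \<in> space F" using space_cond by auto
      then have "e s w \<in> space \<omega>" using measurable_space[OF embed_measurable_fibre] by blast
      then show "u (e s w) * (\<integral>\<^sup>+ z'. v z' \<partial>fibre_move k (e s w)) =
          u (e s w) * (\<integral>\<^sup>+ w'. v (e s w') \<partial>k (e s w))"
        by (simp add: nn_integral_fibre_move[OF k v] proj_embed[OF s w])
    qed
    finally show ?thesis .
  qed
  show "(\<integral>\<^sup>+ z. f z * (\<integral>\<^sup>+ z'. g z' \<partial>fibre_move k z) \<partial>\<omega>) =
      (\<integral>\<^sup>+ z. g z * (\<integral>\<^sup>+ z'. f z' \<partial>fibre_move k z) \<partial>\<omega>)"
    unfolding fibrewise[OF f g] fibrewise[OF g f]
  proof (rule nn_integral_cong)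
    fix s assume "s \<in> space (distr \<omega> S \<pi>)"
    then have s: "s \<in> space S" by simp
    show "(\<integral>\<^sup>+ w. f (e s w) * (\<integral>\<^sup>+ w'. g (e s w') \<partial>k (e s w)) \<partial>c s) =
        (\<integral>\<^sup>+ w. g (e s w) * (\<integral>\<^sup>+ w'. f (e s w') \<partial>k (e s w)) \<partial>c s)"
      using measurable_compose[OF embed_measurable_fibre[OF s] f]
        measurable_compose[OF embed_measurable_fibre[OF s] g] by (rule detailed_balance[OF s])
  qed
qed

lemma cond_proj_kernel: "(\<lambda>z. c (\<pi> z)) \<in> \<omega> \<rightarrow>\<^sub>M prob_algebra F"
  using proj_measurable cond_kernel by (rule measurable_compose)

lemma gibbs_reversible: "reversible_kernel \<omega> gibbs"
  unfolding gibbs_def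
proof (rule fibre_move_reversible[OF cond_proj_kernel])
  fix s and f g :: "'w \<Rightarrow> ennreal"
  assume s: "s \<in> space S" and [measurable]: "f \<in> borel_measurable F" "g \<in> borel_measurable F"
  note [measurable_cong] = sets_cond[OF s]
  have "(\<integral>\<^sup>+ w. u w * (\<integral>\<^sup>+ w'. v w' \<partial>c (\<pi> (e s w))) \<partial>c s) = (\<integral>\<^sup>+ w. u w \<partial>c s) * (\<integral>\<^sup>+ w. v w \<partial>c s)"
    if [measurable]: "u \<in> borel_measurable F" for u v
  proof -
    have "(\<integral>\<^sup>+ w. u w * (\<integral>\<^sup>+ w'. v w' \<partial>c (\<pi> (e s w))) \<partial>c s) = (\<integral>\<^sup>+ w. u w * (\<integral>\<^sup>+ w'. v w' \<partial>c s) \<partial>c s)"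
      using space_cond[OF s] by (intro nn_integral_cong) (simp add: proj_embed[OF s])
    then show ?thesis by (simp add: nn_integral_multc)
  qed
  then show "(\<integral>\<^sup>+ w. f w * (\<integral>\<^sup>+ w'. g w' \<partial>c (\<pi> (e s w))) \<partial>c s) =
      (\<integral>\<^sup>+ w. g w * (\<integral>\<^sup>+ w'. f w' \<partial>c (\<pi> (e s w))) \<partial>c s)"
    by (simp add: mult.commute)
qed

lemma kernel_op_gibbs:
  "f \<in> borel_measurable \<omega> \<Longrightarrow> z \<in> space \<omega> \<Longrightarrow> kernel_op gibbs f z = (\<integral>w. f (e (\<pi> z) w) \<partial>c (\<pi> z))"
  unfolding gibbs_def by (rule kernel_op_fibre_move[OF cond_proj_kernel])

text \<open>
  The image of \<open>f\<close> under the Gibbs update is constant on each fibre, and a move inside the fibre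
  does not change such a function.
\<close>

lemma fibre_move_fixes_gibbs:
  assumes k: "k \<in> \<omega> \<rightarrow>\<^sub>M prob_algebra F" and f: "f \<in> bdd_fun \<omega>" and z: "z \<in> space \<omega>"
  shows "kernel_op (fibre_move k) (kernel_op gibbs f) z = kernel_op gibbs f z"
proof -
  interpret gibbs: reversible_kernel \<omega> gibbs by (rule gibbs_reversible)
  note s = proj_space[OF z] and m = bdd_fun_measurable[OF f]
  have "sets (k z) = sets F" "prob_space (k z)"
    using measurable_space[OF k z] by (auto simp: space_prob_algebra)
  then interpret kz: prob_space "k z" by simp
  have space: "space (k z) = space F" using \<open>sets (k z) = sets F\<close> by (rule sets_eq_imp_space_eq)
  have "kernel_op (fibre_move k) (kernel_op gibbs f) z = (\<integral>w. kernel_op gibbs f (e (\<pi> z) w) \<partial>k z)"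
    by (rule kernel_op_fibre_move[OF k bdd_fun_measurable[OF gibbs.kernel_op_bdd[OF f]] z])
  also have "\<dots> = (\<integral>w. kernel_op gibbs f z \<partial>k z)"
  proof (intro Bochner_Integration.integral_cong refl)
    fix w assume "w \<in> space (k z)"
    then have w: "w \<in> space F" using space by simp
    then have "e (\<pi> z) w \<in> space \<omega>" using measurable_space[OF embed_measurable_fibre[OF s]] by blast
    then show "kernel_op gibbs f (e (\<pi> z) w) = kernel_op gibbs f z"
      by (simp add: kernel_op_gibbs[OF m] z proj_embed[OF s w])
  qed
  finally show ?thesis by (simp add: kz.prob_space)
qed

lemma gibbs_idempotent:
  "f \<in> bdd_fun \<omega> \<Longrightarrow> z \<in> space \<omega> \<Longrightarrow> kernel_op gibbs (kernel_op gibbs f) z = kernel_op gibbs f z"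
  using fibre_move_fixes_gibbs[OF cond_proj_kernel] unfolding gibbs_def[symmetric] .

end

section \<open>The two Gibbs updates\<close>

text \<open>
  The updates of a single coordinate are defined as product measures with a point mass; the next
  two lemmas rewrite them as images of a measure on one factor, the form of a move in a fibre.
\<close>

lemma return_pair_eq_distr:
  assumes "x \<in> space M" "prob_space N"
  shows "return M x \<Otimes>\<^sub>M N = distr N (M \<Otimes>\<^sub>M N) (Pair x)"
proof (rule pair_measure_eqI)
  interpret N: prob_space N by fact
  interpret R: prob_space "return M x" using assms(1) by (rule prob_space_return)
  show "sigma_finite_measure (return M x)" "sigma_finite_measure N" by unfold_locales
  show "sets (return M x \<Otimes>\<^sub>M N) = sets (distr N (M \<Otimes>\<^sub>M N) (Pair x))"
    by (simp cong: sets_pair_measure_cong)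
  fix A B assume A: "A \<in> sets (return M x)" and B: "B \<in> sets N"
  have "Pair x -` (A \<times> B) \<inter> space N = (if x \<in> A then B else {})"
    using sets.sets_into_space[OF B] by auto
  then show "emeasure (return M x) A * emeasure N B = emeasure (distr N (M \<Otimes>\<^sub>M N) (Pair x)) (A \<times> B)"
    using A B assms(1) by (subst emeasure_distr) (auto simp: indicator_def)
qed

lemma pair_return_eq_distr:
  assumes "y \<in> space N" "prob_space M"
  shows "M \<Otimes>\<^sub>M return N y = distr M (M \<Otimes>\<^sub>M N) (\<lambda>x. (x, y))"
proof (rule pair_measure_eqI)
  interpret M: prob_space M by fact
  interpret R: prob_space "return N y" using assms(1) by (rule prob_space_return)
  show "sigma_finite_measure (return N y)" "sigma_finite_measure M" by unfold_locales
  show "sets (M \<Otimes>\<^sub>M return N y) = sets (distr M (M \<Otimes>\<^sub>M N) (\<lambda>x. (x, y)))"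
    by (simp cong: sets_pair_measure_cong)
  fix A B assume A: "A \<in> sets M" and B: "B \<in> sets (return N y)"
  have "(\<lambda>x. (x, y)) -` (A \<times> B) \<inter> space M = (if y \<in> B then A else {})"
    using sets.sets_into_space[OF A] by auto
  then show "emeasure M A * emeasure (return N y) B = emeasure (distr M (M \<Otimes>\<^sub>M N) (\<lambda>x. (x, y))) (A \<times> B)"
    using A B assms(1) by (subst emeasure_distr) (auto simp: indicator_def)
qed

text \<open>
  Regular conditional distributions are specified on rectangles, which determine a measure on the
  product.
\<close>

lemma disintegrationI:
  assumes "prob_space PJ" "sets PJ = sets (MX \<Otimes>\<^sub>M MY)" "sets m = sets S" "space m \<noteq> {}"
    and J: "J \<in> S \<rightarrow>\<^sub>M prob_algebra PJ"
    and rect: "\<And>A B. A \<in> sets MX \<Longrightarrow> B \<in> sets MY \<Longrightarrow> emeasure PJ (A \<times> B) = (\<integral>\<^sup>+ s. emeasure (J s) (A \<times> B) \<partial>m)"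
  shows "PJ = m \<bind> J"
proof -
  interpret prob_space PJ by fact
  have J': "J \<in> m \<rightarrow>\<^sub>M subprob_algebra PJ"
    using measurable_prob_algebraD[OF J] assms(3) by (simp cong: measurable_cong_sets)
  let ?E = "{A \<times> B |A B. A \<in> sets MX \<and> B \<in> sets MY}"
  show ?thesis
  proof (rule measure_eqI_generator_eq[where A="\<lambda>_. space MX \<times> space MY"])
    show "Int_stable ?E" by (rule Int_stable_pair_measure_generator)
    show "?E \<subseteq> Pow (space MX \<times> space MY)" by (rule pair_measure_closed)
    show "sets PJ = sigma_sets (space MX \<times> space MY) ?E"
      unfolding assms(2) by (rule sets_pair_measure)
    show "sets (m \<bind> J) = sigma_sets (space MX \<times> space MY) ?E"
      unfolding sets_pair_measure[symmetric] assms(2)[symmetric]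
      using subprob_measurableD(2)[OF J'] assms(4) by (rule sets_bind)
    show "emeasure PJ X = emeasure (m \<bind> J) X" if "X \<in> ?E" for X
    proof -
      obtain A B where X: "X = A \<times> B" and AB: "A \<in> sets MX" "B \<in> sets MY" using \<open>X \<in> ?E\<close> by blast
      have "A \<times> B \<in> sets PJ" unfolding assms(2) using AB by (rule pair_measureI)
      then show ?thesis unfolding X using rect[OF AB] emeasure_bind[OF assms(4) J'] by simp
    qed
  qed auto
qed

locale bivariate_model = prob_space PJ for PJ :: "('x \<times> 'y) measure" +
  fixes MX :: "'x measure" and MY :: "'y measure"
    and dXY :: "'x \<Rightarrow> 'y \<Rightarrow> real" and dYX :: "'y \<Rightarrow> 'x \<Rightarrow> real"
  assumes sigma_finite_X: "sigma_finite_measure MX"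
    and sets_joint: "sets PJ = sets (MX \<Otimes>\<^sub>M MY)"
    and density_X: "conditional_density MX MY dXY"
    and conditional_X: "is_conditional_X_given_Y MX MY PJ (conditional_dist MX dXY)"
    and conditional_Y: "is_conditional_Y_given_X MX MY PJ (conditional_dist MY dYX)"
begin

lemma measurable_joint_cong: "measurable PJ = measurable (MX \<Otimes>\<^sub>M MY)" "measurable N PJ = measurable N (MX \<Otimes>\<^sub>M MY)"
  using sets_joint by (auto intro!: ext measurable_cong_sets)

lemma space_joint: "space PJ = space MX \<times> space MY"
  using sets_eq_imp_space_eq[OF sets_joint] by (simp add: space_pair_measure)

lemma cond_X_kernel: "conditional_dist MX dXY \<in> MY \<rightarrow>\<^sub>M prob_algebra MX"
  using conditional_X unfolding is_conditional_X_given_Y_def by simp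

lemma cond_Y_kernel: "conditional_dist MY dYX \<in> MX \<rightarrow>\<^sub>M prob_algebra MY"
  using conditional_Y unfolding is_conditional_Y_given_X_def by simp

sublocale X: fibred_measure PJ MY MX snd "\<lambda>y x. (x, y)" "conditional_dist MX dXY"
proof unfold_locales
  show "snd \<in> PJ \<rightarrow>\<^sub>M MY" unfolding measurable_joint_cong by measurable
  show embed: "(\<lambda>(y, x). (x, y)) \<in> MY \<Otimes>\<^sub>M MX \<rightarrow>\<^sub>M PJ" unfolding measurable_joint_cong by measurable
  show "conditional_dist MX dXY \<in> MY \<rightarrow>\<^sub>M prob_algebra MX" by (rule cond_X_kernel)
  show "PJ = distr PJ MY snd \<bind> (\<lambda>y. distr (conditional_dist MX dXY y) PJ (\<lambda>x. (x, y)))"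
  proof (rule disintegrationI[OF prob_space_axioms sets_joint, where S=MY])
    show "space (distr PJ MY snd) \<noteq> {}" using not_empty space_joint by auto
    show "(\<lambda>y. distr (conditional_dist MX dXY y) PJ (\<lambda>x. (x, y))) \<in> MY \<rightarrow>\<^sub>M prob_algebra PJ"
      using cond_X_kernel embed by (rule measurable_distr_prob_space2)
    fix A B assume AB: "A \<in> sets MX" "B \<in> sets MY"
    have "emeasure PJ (A \<times> B) = (\<integral>\<^sup>+ y \<in> B. emeasure (conditional_dist MX dXY y) A \<partial>distr PJ MY snd)"
      using conditional_X AB unfolding is_conditional_X_given_Y_def marginal_Y_def by blast
    also have "\<dots> = (\<integral>\<^sup>+ y. emeasure (distr (conditional_dist MX dXY y) PJ (\<lambda>x. (x, y))) (A \<times> B) \<partial>distr PJ MY snd)"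
    proof (rule nn_integral_cong)
      fix y assume "y \<in> space (distr PJ MY snd)"
      then have y: "y \<in> space MY" by simp
      have c: "sets (conditional_dist MX dXY y) = sets MX" "space (conditional_dist MX dXY y) = space MX"
        unfolding conditional_dist_def by simp_all
      have "(\<lambda>x. (x, y)) \<in> conditional_dist MX dXY y \<rightarrow>\<^sub>M PJ"
        using y c(1) measurable_Pair2'[of y MY MX] unfolding measurable_joint_cong
        by (simp cong: measurable_cong_sets)
      moreover have "A \<times> B \<in> sets PJ" unfolding sets_joint using AB by (rule pair_measureI)
      moreover have "(\<lambda>x. (x, y)) -` (A \<times> B) \<inter> space (conditional_dist MX dXY y) = (if y \<in> B then A else {})"
        using sets.sets_into_space[OF AB(1)] c by auto
      ultimately show "emeasure (conditional_dist MX dXY y) A * indicator B y =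
          emeasure (distr (conditional_dist MX dXY y) PJ (\<lambda>x. (x, y))) (A \<times> B)"
        by (simp add: emeasure_distr)
    qed
    finally show "emeasure PJ (A \<times> B) = \<dots>" .
  qed simp
qed auto

sublocale Y: fibred_measure PJ MX MY fst Pair "conditional_dist MY dYX"
proof unfold_locales
  show "fst \<in> PJ \<rightarrow>\<^sub>M MX" unfolding measurable_joint_cong by measurable
  show embed: "(\<lambda>(x, y). (x, y)) \<in> MX \<Otimes>\<^sub>M MY \<rightarrow>\<^sub>M PJ" unfolding measurable_joint_cong by measurable
  show "conditional_dist MY dYX \<in> MX \<rightarrow>\<^sub>M prob_algebra MY" by (rule cond_Y_kernel)
  show "PJ = distr PJ MX fst \<bind> (\<lambda>x. distr (conditional_dist MY dYX x) PJ (Pair x))"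
  proof (rule disintegrationI[OF prob_space_axioms sets_joint, where S=MX])
    show "space (distr PJ MX fst) \<noteq> {}" using not_empty space_joint by auto
    show "(\<lambda>x. distr (conditional_dist MY dYX x) PJ (Pair x)) \<in> MX \<rightarrow>\<^sub>M prob_algebra PJ"
      using cond_Y_kernel embed by (rule measurable_distr_prob_space2)
    fix A B assume AB: "A \<in> sets MX" "B \<in> sets MY"
    have "emeasure PJ (A \<times> B) = (\<integral>\<^sup>+ x \<in> A. emeasure (conditional_dist MY dYX x) B \<partial>distr PJ MX fst)"
      using conditional_Y AB unfolding is_conditional_Y_given_X_def marginal_X_def by blast
    also have "\<dots> = (\<integral>\<^sup>+ x. emeasure (distr (conditional_dist MY dYX x) PJ (Pair x)) (A \<times> B) \<partial>distr PJ MX fst)"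
    proof (rule nn_integral_cong)
      fix x assume "x \<in> space (distr PJ MX fst)"
      then have x: "x \<in> space MX" by simp
      have c: "sets (conditional_dist MY dYX x) = sets MY" "space (conditional_dist MY dYX x) = space MY"
        unfolding conditional_dist_def by simp_all
      have "Pair x \<in> conditional_dist MY dYX x \<rightarrow>\<^sub>M PJ"
        using x c(1) measurable_Pair1'[of x MX MY] unfolding measurable_joint_cong
        by (simp cong: measurable_cong_sets)
      moreover have "A \<times> B \<in> sets PJ" unfolding sets_joint using AB by (rule pair_measureI)
      moreover have "Pair x -` (A \<times> B) \<inter> space (conditional_dist MY dYX x) = (if x \<in> A then B else {})"
        using sets.sets_into_space[OF AB(2)] c by auto
      ultimately show "emeasure (conditional_dist MY dYX x) B * indicator A x =
          emeasure (distr (conditional_dist MY dYX x) PJ (Pair x)) (A \<times> B)"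
        by (simp add: emeasure_distr)
    qed
    finally show "emeasure PJ (A \<times> B) = \<dots>" .
  qed simp
qed auto

lemma X_fibre_move_eq:
  assumes "x \<in> space MX" "y \<in> space MY" "prob_space (k (x, y))" "sets (k (x, y)) = sets MX"
  shows "X.fibre_move k (x, y) = k (x, y) \<Otimes>\<^sub>M return MY y"
  unfolding X.fibre_move_def pair_return_eq_distr[OF assms(2,3)]
  using assms(4) sets_joint by (intro distr_cong) (auto cong: sets_pair_measure_cong)

lemma Y_gibbs_eq:
  assumes "x \<in> space MX" "y \<in> space MY"
  shows "Y.gibbs (x, y) = return MX x \<Otimes>\<^sub>M conditional_dist MY dYX x"
proof -
  have "prob_space (conditional_dist MY dYX x)"
    using measurable_space[OF cond_Y_kernel assms(1)] by (simp add: space_prob_algebra)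
  note eq = return_pair_eq_distr[OF assms(1) this]
  show ?thesis
    unfolding Y.gibbs_def Y.fibre_move_def eq
    using Y.sets_cond[OF assms(1)] sets_joint by (intro distr_cong) (auto cong: sets_pair_measure_cong)
qed

lemma P_DG_eq:
  assumes "x \<in> space MX" "y \<in> space MY"
  shows "P_DG MX MY dXY dYX (x, y) =
    conditional_dist MY dYX x \<bind> (\<lambda>y'. distr (conditional_dist MX dXY y') PJ (\<lambda>x'. (x', y')))"
proof -
  have "conditional_dist MX dXY y' \<Otimes>\<^sub>M return MY y' = distr (conditional_dist MX dXY y') PJ (\<lambda>x'. (x', y'))"
    if y': "y' \<in> space MY" for y'
  proof -
    have c: "prob_space (conditional_dist MX dXY y')"
      using measurable_space[OF cond_X_kernel y'] by (simp add: space_prob_algebra)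
    show ?thesis
      unfolding pair_return_eq_distr[OF y' c]
      using X.sets_cond[OF y'] sets_joint by (intro distr_cong) (auto cong: sets_pair_measure_cong)
  qed
  then show ?thesis
    unfolding P_DG_def prod.case using Y.space_cond[OF assms(1)] by (intro bind_cong) auto
qed

lemma X_update_kernel: "(\<lambda>y. distr (conditional_dist MX dXY y) PJ (\<lambda>x. (x, y))) \<in> MY \<rightarrow>\<^sub>M prob_algebra PJ"
  using cond_X_kernel X.embed_measurable by (rule measurable_distr_prob_space2)

lemma markov_kernel_P_DG: "markov_kernel PJ (P_DG MX MY dXY dYX)"
proof (unfold_locales)
  have "(\<lambda>z. conditional_dist MY dYX (fst z) \<bind> (\<lambda>y'. distr (conditional_dist MX dXY y') PJ (\<lambda>x'. (x', y'))))
      \<in> PJ \<rightarrow>\<^sub>M prob_algebra PJ"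
    by (rule measurable_bind_prob_space[OF Y.cond_proj_kernel X_update_kernel])
  then show "P_DG MX MY dXY dYX \<in> PJ \<rightarrow>\<^sub>M prob_algebra PJ"
    by (subst measurable_cong[of PJ]) (auto simp: space_joint P_DG_eq)
qed

text \<open>
  The sampler draws \<open>y\<close> first and \<open>x\<close> second; the operators compose in the opposite order, so the
  average over \<open>x\<close> is taken first.
\<close>

lemma kernel_op_P_DG:
  assumes f: "f \<in> bdd_fun PJ" and z: "z \<in> space PJ"
  shows "kernel_op (P_DG MX MY dXY dYX) f z = kernel_op Y.gibbs (kernel_op X.gibbs f) z"
proof -
  interpret gibbs_X: reversible_kernel PJ X.gibbs by (rule X.gibbs_reversible)
  obtain x y where z_eq: "z = (x, y)" and x: "x \<in> space MX" and y: "y \<in> space MY"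
    using z unfolding space_joint by auto
  note m = bdd_fun_measurable[OF f]
  note J = measurable_prob_algebraD[OF X_update_kernel]
  have cY: "prob_space (conditional_dist MY dYX x)" "sets (conditional_dist MY dYX x) = sets MY"
    using measurable_space[OF cond_Y_kernel x] by (auto simp: space_prob_algebra)
  then interpret cY: prob_space "conditional_dist MY dYX x" by simp
  have space_cY: "space (conditional_dist MY dYX x) = space MY" using cY(2) by (rule sets_eq_imp_space_eq)
  obtain b where b: "0 < b" "\<And>z. z \<in> space PJ \<Longrightarrow> \<bar>f z\<bar> \<le> b" by (rule bdd_funE[OF f]) blast
  have "kernel_op (P_DG MX MY dXY dYX) f z =
      (\<integral>z'. f z' \<partial>(conditional_dist MY dYX x \<bind> (\<lambda>y'. distr (conditional_dist MX dXY y') PJ (\<lambda>x'. (x', y')))))"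
    unfolding kernel_op_def z_eq P_DG_eq[OF x y] ..
  also have "\<dots> = (\<integral>y'. \<integral>z'. f z' \<partial>distr (conditional_dist MX dXY y') PJ (\<lambda>x'. (x', y')) \<partial>conditional_dist MY dYX x)"
  proof (rule integral_bind[OF m b(2), where B'=1])
    show "(\<lambda>y'. distr (conditional_dist MX dXY y') PJ (\<lambda>x'. (x', y'))) \<in> conditional_dist MY dYX x \<rightarrow>\<^sub>M subprob_algebra PJ"
      using J cY(2) by (simp cong: measurable_cong_sets)
    show "finite_measure (conditional_dist MY dYX x)" by unfold_locales
    show "AE y' in conditional_dist MY dYX x.
        emeasure (distr (conditional_dist MX dXY y') PJ (\<lambda>x'. (x', y')))
          (space (distr (conditional_dist MX dXY y') PJ (\<lambda>x'. (x', y')))) \<le> ennreal 1"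
      using subprob_space.emeasure_space_le_1[OF subprob_space_kernel[OF J]] space_cY
      by (intro AE_I2) simp
  qed
  also have "\<dots> = (\<integral>y'. kernel_op X.gibbs f (x, y') \<partial>conditional_dist MY dYX x)"
    using space_cY x
    by (intro Bochner_Integration.integral_cong refl)
       (simp add: kernel_op_def X.gibbs_def X.fibre_move_def)
  also have "\<dots> = kernel_op Y.gibbs (kernel_op X.gibbs f) z"
    using Y.kernel_op_gibbs[OF bdd_fun_measurable[OF gibbs_X.kernel_op_bdd[OF f]] z] by (simp add: z_eq)
  finally show ?thesis .
qed

end

section \<open>The Metropolis-Hastings update\<close>

lemma P_MH_mixture:
  assumes [measurable]: "(\<lambda>z. q z (x, y) * MH_accept dXY q z (x, y)) \<in> borel_measurable MX"
    and x: "x \<in> space MX"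
  defines "h z \<equiv> ennreal (q z (x, y) * MH_accept dXY q z (x, y))"
  shows P_MH_sets: "sets (P_MH MX dXY q (x, y)) = sets MX"
    and P_MH_emeasure: "A \<in> sets MX \<Longrightarrow> emeasure (P_MH MX dXY q (x, y)) A =
      (\<integral>\<^sup>+ z \<in> A. h z \<partial>MX) + (1 - (\<integral>\<^sup>+ z. h z \<partial>MX)) * indicator A x"
    and P_MH_nn_integral: "f \<in> borel_measurable MX \<Longrightarrow> (\<integral>\<^sup>+ z. f z \<partial>P_MH MX dXY q (x, y)) =
      (\<integral>\<^sup>+ z. h z * f z \<partial>MX) + (1 - (\<integral>\<^sup>+ z. h z \<partial>MX)) * f x"
proof -
  have h [measurable]: "h \<in> borel_measurable MX" unfolding h_def by measurable
  show "sets (P_MH MX dXY q (x, y)) = sets MX" unfolding P_MH_def by simp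
  note eq = mixture_measure[of "density MX h" MX "return MX x" "P_MH MX dXY q (x, y)" _
      1 "1 - (\<integral>\<^sup>+ z. h z \<partial>MX)", OF _ _ P_MH_def[THEN fun_cong, of MX dXY q "(x, y)", unfolded prod.case]]
  show "A \<in> sets MX \<Longrightarrow> emeasure (P_MH MX dXY q (x, y)) A =
      (\<integral>\<^sup>+ z \<in> A. h z \<partial>MX) + (1 - (\<integral>\<^sup>+ z. h z \<partial>MX)) * indicator A x"
    by (subst eq(1)) (auto simp: emeasure_density h_def[symmetric])
  show "f \<in> borel_measurable MX \<Longrightarrow> (\<integral>\<^sup>+ z. f z \<partial>P_MH MX dXY q (x, y)) =
      (\<integral>\<^sup>+ z. h z * f z \<partial>MX) + (1 - (\<integral>\<^sup>+ z. h z \<partial>MX)) * f x"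
    using x by (subst eq(2)) (auto simp: emeasure_density h_def[symmetric] nn_integral_density nn_integral_return)
qed

text \<open>
  The acceptance probability is chosen so that the flow from \<open>x\<close> to \<open>z\<close> equals
  \<open>min (\<pi>(x) q(z|x)) (\<pi>(z) q(x|z))\<close>, also when the denominator vanishes, for then both sides
  are zero.
\<close>

lemma MH_flow_symmetric:
  assumes "0 \<le> dXY x y" "0 \<le> dXY z y" "0 \<le> q z (x, y)" "0 \<le> q x (z, y)"
  shows "dXY x y * (q z (x, y) * MH_accept dXY q z (x, y)) = dXY z y * (q x (z, y) * MH_accept dXY q x (z, y))"
proof -
  have scale: "a * min 1 (b / a) = min a b" if "0 < a" for a b :: real
    using that by (simp add: min_mult_distrib_left)
  have flow: "dXY x y * (q z (x, y) * MH_accept dXY q z (x, y)) = min (dXY x y * q z (x, y)) (dXY z y * q x (z, y))"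
    if "0 \<le> dXY x y" "0 \<le> dXY z y" "0 \<le> q z (x, y)" "0 \<le> q x (z, y)" for x z
  proof (cases "dXY x y * q z (x, y) = 0")
    case True
    then show ?thesis using that by (auto simp: MH_accept_def min_def)
  next
    case False
    then have pos: "0 < dXY x y * q z (x, y)" using that by (simp add: order_less_le)
    have "dXY x y * (q z (x, y) * MH_accept dXY q z (x, y)) =
        (dXY x y * q z (x, y)) * min 1 (dXY z y * q x (z, y) / (dXY x y * q z (x, y)))"
      using False by (simp add: MH_accept_def)
    also have "\<dots> = min (dXY x y * q z (x, y)) (dXY z y * q x (z, y))"
      using scale[OF pos] .
    finally show ?thesis .
  qed
  show ?thesis using flow[of x z] flow[of z x] assms by (simp add: min.commute)
qed

lemma MH_accept_bounds:
  assumes "0 \<le> dXY x y" "0 \<le> dXY z y" "0 \<le> q z (x, y)" "0 \<le> q x (z, y)"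
  shows "0 \<le> MH_accept dXY q z (x, y)" "MH_accept dXY q z (x, y) \<le> 1"
  using assms by (auto simp: MH_accept_def min_def)

locale metropolis_within_gibbs = bivariate_model +
  fixes q :: "'a \<Rightarrow> 'a \<times> 'b \<Rightarrow> real"
  assumes proposal: "conditional_density MX (MX \<Otimes>\<^sub>M MY) q"
begin

lemma dXY_nonneg: "x \<in> space MX \<Longrightarrow> y \<in> space MY \<Longrightarrow> 0 \<le> dXY x y"
  using density_X unfolding conditional_density_def by blast

lemma q_nonneg: "z \<in> space MX \<Longrightarrow> x \<in> space MX \<Longrightarrow> y \<in> space MY \<Longrightarrow> 0 \<le> q z (x, y)"
  and q_mass: "x \<in> space MX \<Longrightarrow> y \<in> space MY \<Longrightarrow> (\<integral>\<^sup>+ z. ennreal (q z (x, y)) \<partial>MX) = 1"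
  using proposal unfolding conditional_density_def by (auto simp: space_pair_measure)

lemma dXY_measurable [measurable (raw)]:
  assumes "f \<in> N \<rightarrow>\<^sub>M MX" "g \<in> N \<rightarrow>\<^sub>M MY"
  shows "(\<lambda>w. dXY (f w) (g w)) \<in> borel_measurable N"
proof -
  have "(\<lambda>(x, y). dXY x y) \<in> borel_measurable (MX \<Otimes>\<^sub>M MY)"
    using density_X unfolding conditional_density_def by blast
  from measurable_compose[OF measurable_Pair[OF assms] this] show ?thesis by simp
qed

lemma q_measurable [measurable (raw)]:
  assumes "f \<in> N \<rightarrow>\<^sub>M MX" "g \<in> N \<rightarrow>\<^sub>M MX" "h \<in> N \<rightarrow>\<^sub>M MY"
  shows "(\<lambda>w. q (f w) (g w, h w)) \<in> borel_measurable N"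
proof -
  have "(\<lambda>(z, c). q z c) \<in> borel_measurable (MX \<Otimes>\<^sub>M (MX \<Otimes>\<^sub>M MY))"
    using proposal unfolding conditional_density_def by blast
  from measurable_compose[OF measurable_Pair[OF assms(1) measurable_Pair[OF assms(2,3)]] this]
  show ?thesis by simp
qed

definition accepted_density :: "'a \<Rightarrow> 'a \<Rightarrow> 'b \<Rightarrow> real" where
  "accepted_density z x y = q z (x, y) * MH_accept dXY q z (x, y)"

lemma accepted_density_measurable [measurable (raw)]:
  assumes [measurable]: "f \<in> N \<rightarrow>\<^sub>M MX" "g \<in> N \<rightarrow>\<^sub>M MX" "h \<in> N \<rightarrow>\<^sub>M MY"
  shows "(\<lambda>w. accepted_density (f w) (g w) (h w)) \<in> borel_measurable N"
  unfolding accepted_density_def MH_accept_def prod.case by measurable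

lemma accepted_density_bounds:
  assumes "z \<in> space MX" "x \<in> space MX" "y \<in> space MY"
  shows "0 \<le> accepted_density z x y" "accepted_density z x y \<le> q z (x, y)"
  using assms MH_accept_bounds[of dXY x y z q] dXY_nonneg q_nonneg
  unfolding accepted_density_def by (auto intro!: mult_nonneg_nonneg mult_left_le)

lemma accepted_density_mass_le_1:
  assumes "x \<in> space MX" "y \<in> space MY"
  shows "(\<integral>\<^sup>+ z. ennreal (accepted_density z x y) \<partial>MX) \<le> 1"
  unfolding q_mass[OF assms, symmetric]
  by (intro nn_integral_mono ennreal_leI) (rule accepted_density_bounds(2)[OF _ assms])

abbreviation "MH \<equiv> P_MH MX dXY q"

lemma
  assumes x: "x \<in> space MX" and y: "y \<in> space MY"
  shows sets_MH: "sets (MH (x, y)) = sets MX"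
    and emeasure_MH: "A \<in> sets MX \<Longrightarrow> emeasure (MH (x, y)) A =
      (\<integral>\<^sup>+ z \<in> A. ennreal (accepted_density z x y) \<partial>MX) + (1 - (\<integral>\<^sup>+ z. ennreal (accepted_density z x y) \<partial>MX)) * indicator A x"
    and nn_integral_MH: "f \<in> borel_measurable MX \<Longrightarrow> (\<integral>\<^sup>+ z. f z \<partial>MH (x, y)) =
      (\<integral>\<^sup>+ z. ennreal (accepted_density z x y) * f z \<partial>MX) + (1 - (\<integral>\<^sup>+ z. ennreal (accepted_density z x y) \<partial>MX)) * f x"
proof -
  have "(\<lambda>z. accepted_density z x y) \<in> borel_measurable MX" using x y by measurable
  then have meas: "(\<lambda>z. q z (x, y) * MH_accept dXY q z (x, y)) \<in> borel_measurable MX"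
    unfolding accepted_density_def .
  note * = P_MH_mixture[OF meas x, folded accepted_density_def]
  show "sets (MH (x, y)) = sets MX" by (rule *(1))
  show "A \<in> sets MX \<Longrightarrow> emeasure (MH (x, y)) A =
      (\<integral>\<^sup>+ z \<in> A. ennreal (accepted_density z x y) \<partial>MX) + (1 - (\<integral>\<^sup>+ z. ennreal (accepted_density z x y) \<partial>MX)) * indicator A x"
    by (rule *(2))
  show "f \<in> borel_measurable MX \<Longrightarrow> (\<integral>\<^sup>+ z. f z \<partial>MH (x, y)) =
      (\<integral>\<^sup>+ z. ennreal (accepted_density z x y) * f z \<partial>MX) + (1 - (\<integral>\<^sup>+ z. ennreal (accepted_density z x y) \<partial>MX)) * f x"
    by (rule *(3))
qed

lemma prob_space_MH:
  assumes x: "x \<in> space MX" and y: "y \<in> space MY"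
  shows "prob_space (MH (x, y))"
proof
  have "space (MH (x, y)) = space MX" using sets_MH[OF x y] by (rule sets_eq_imp_space_eq)
  moreover have "(\<integral>\<^sup>+ z \<in> space MX. ennreal (accepted_density z x y) \<partial>MX) = (\<integral>\<^sup>+ z. ennreal (accepted_density z x y) \<partial>MX)"
    by (rule nn_integral_cong) simp
  ultimately show "emeasure (MH (x, y)) (space (MH (x, y))) = 1"
    using emeasure_MH[OF x y, of "space MX"] x add_diff_inverse_ennreal[OF accepted_density_mass_le_1[OF x y]]
    by simp
qed

lemma MH_kernel: "MH \<in> PJ \<rightarrow>\<^sub>M prob_algebra MX"
proof (intro measurable_prob_algebraI measurable_subprob_algebra)
  fix z assume "z \<in> space PJ"
  then obtain x y where z: "z = (x, y)" and xy: "x \<in> space MX" "y \<in> space MY"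
    unfolding space_joint by auto
  show "prob_space (MH z)" unfolding z using xy by (rule prob_space_MH)
  then show "subprob_space (MH z)" by (rule prob_space_imp_subprob_space)
  show "sets (MH z) = sets MX" unfolding z using xy by (rule sets_MH)
next
  interpret MX: sigma_finite_measure MX by (rule sigma_finite_X)
  fix A assume [measurable]: "A \<in> sets MX"
  have "(\<lambda>p. (\<integral>\<^sup>+ z \<in> A. ennreal (accepted_density z (fst p) (snd p)) \<partial>MX) +
      (1 - (\<integral>\<^sup>+ z. ennreal (accepted_density z (fst p) (snd p)) \<partial>MX)) * indicator A (fst p)) \<in> borel_measurable PJ"
    unfolding measurable_joint_cong by measurable
  then show "(\<lambda>p. emeasure (MH p) A) \<in> borel_measurable PJ"
    by (rule measurable_cong[THEN iffD1, rotated]) (auto simp: space_joint emeasure_MH)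
qed

text \<open>
  The absolutely continuous part of the kernel contributes a double integral against the
  symmetric flow, in which Tonelli's theorem exchanges the two points; the rejection part
  contributes \<open>f x * g x\<close>, which is symmetric.
\<close>

lemma MH_detailed_balance:
  assumes y: "y \<in> space MY" and [measurable]: "f \<in> borel_measurable MX" "g \<in> borel_measurable MX"
  shows "(\<integral>\<^sup>+ x. f x * (\<integral>\<^sup>+ z. g z \<partial>MH (x, y)) \<partial>conditional_dist MX dXY y) =
    (\<integral>\<^sup>+ x. g x * (\<integral>\<^sup>+ z. f z \<partial>MH (x, y)) \<partial>conditional_dist MX dXY y)"
proof -
  interpret MX: sigma_finite_measure MX by (rule sigma_finite_X)
  interpret pair_sigma_finite MX MX ..
  \<comment> \<open>\<open>flow x z\<close> is the joint density of an accepted move, \<open>stay x\<close> the density of a rejected one\<close>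
  define flow where "flow x z = ennreal (dXY x y * accepted_density z x y)" for x z
  have flow_measurable: "(\<lambda>w. flow (fst w) (snd w)) \<in> borel_measurable (MX \<Otimes>\<^sub>M MX)"
    unfolding flow_def using y by measurable
  have flow_sym: "flow x z = flow z x" if "x \<in> space MX" "z \<in> space MX" for x z
    unfolding flow_def accepted_density_def using that y dXY_nonneg q_nonneg
    by (subst MH_flow_symmetric) auto
  define stay where "stay x = ennreal (dXY x y) * (1 - (\<integral>\<^sup>+ z. ennreal (accepted_density z x y) \<partial>MX))" for x
  have stay_measurable: "stay \<in> borel_measurable MX"
    unfolding stay_def using y by measurable
  have dens_measurable: "(\<lambda>x. dXY x y) \<in> borel_measurable MX" using y by measurable
  have split: "(\<integral>\<^sup>+ x. u x * (\<integral>\<^sup>+ z. v z \<partial>MH (x, y)) \<partial>conditional_dist MX dXY y) =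
      (\<integral>\<^sup>+ x. \<integral>\<^sup>+ z. flow x z * (u x * v z) \<partial>MX \<partial>MX) + (\<integral>\<^sup>+ x. stay x * (u x * v x) \<partial>MX)"
    if [measurable]: "u \<in> borel_measurable MX" "v \<in> borel_measurable MX" for u v
  proof -
    note [measurable] = stay_measurable flow_measurable dens_measurable
    have "(\<lambda>p. \<integral>\<^sup>+ z. v z \<partial>MH p) \<in> borel_measurable PJ"
      using measurable_compose[OF measurable_prob_algebraD[OF MH_kernel]
        nn_integral_measurable_subprob_algebra[OF that(2)]] .
    from measurable_compose[OF X.embed_measurable_fibre[OF y] this]
    have [measurable]: "(\<lambda>x. \<integral>\<^sup>+ z. v z \<partial>MH (x, y)) \<in> borel_measurable MX" .
    have "(\<integral>\<^sup>+ x. u x * (\<integral>\<^sup>+ z. v z \<partial>MH (x, y)) \<partial>conditional_dist MX dXY y) =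
        (\<integral>\<^sup>+ x. ennreal (dXY x y) * (u x * (\<integral>\<^sup>+ z. v z \<partial>MH (x, y))) \<partial>MX)"
      unfolding conditional_dist_def by (rule nn_integral_density) measurable
    also have "\<dots> = (\<integral>\<^sup>+ x. (\<integral>\<^sup>+ z. flow x z * (u x * v z) \<partial>MX) + stay x * (u x * v x) \<partial>MX)"
    proof (rule nn_integral_cong)
      fix x assume x: "x \<in> space MX"
      have accepted_density_x [measurable]: "(\<lambda>z. accepted_density z x y) \<in> borel_measurable MX" using x y by measurable
      have "(\<integral>\<^sup>+ z. flow x z * (u x * v z) \<partial>MX) =
          (\<integral>\<^sup>+ z. (ennreal (dXY x y) * u x) * (ennreal (accepted_density z x y) * v z) \<partial>MX)"
        unfolding flow_def using dXY_nonneg[OF x y] accepted_density_bounds(1)[OF _ x y]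
        by (intro nn_integral_cong) (simp add: ennreal_mult ac_simps)
      also have "\<dots> = (ennreal (dXY x y) * u x) * (\<integral>\<^sup>+ z. ennreal (accepted_density z x y) * v z \<partial>MX)"
        by (rule nn_integral_cmult) measurable
      finally show "ennreal (dXY x y) * (u x * (\<integral>\<^sup>+ z. v z \<partial>MH (x, y))) =
          (\<integral>\<^sup>+ z. flow x z * (u x * v z) \<partial>MX) + stay x * (u x * v x)"
        unfolding stay_def by (simp add: nn_integral_MH[OF x y] distrib_left ac_simps)
    qed
    also have "\<dots> = (\<integral>\<^sup>+ x. \<integral>\<^sup>+ z. flow x z * (u x * v z) \<partial>MX \<partial>MX) + (\<integral>\<^sup>+ x. stay x * (u x * v x) \<partial>MX)"
      by (rule nn_integral_add) measurable
    finally show ?thesis .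
  qed
  have "(\<integral>\<^sup>+ x. \<integral>\<^sup>+ z. flow x z * (f x * g z) \<partial>MX \<partial>MX) = (\<integral>\<^sup>+ z. \<integral>\<^sup>+ x. flow x z * (f x * g z) \<partial>MX \<partial>MX)"
  proof -
    note [measurable] = flow_measurable
    show ?thesis by (rule Fubini'[symmetric]) measurable
  qed
  also have "\<dots> = (\<integral>\<^sup>+ z. \<integral>\<^sup>+ x. flow z x * (g z * f x) \<partial>MX \<partial>MX)"
    by (intro nn_integral_cong) (simp add: flow_sym mult.commute)
  finally show ?thesis by (simp add: split mult.commute)
qed

lemma MH_move_reversible: "reversible_kernel PJ (X.fibre_move MH)"
  by (rule X.fibre_move_reversible[OF MH_kernel MH_detailed_balance])

lemma P_RC_eq:
  assumes "z \<in> space PJ"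
  shows "P_RC MX MY dXY dYX q r z = measure_of (space PJ) (sets PJ)
    (\<lambda>E. ennreal r * emeasure (X.fibre_move MH z) E + ennreal (1 - r) * emeasure (Y.gibbs z) E)"
proof -
  obtain x y where z: "z = (x, y)" and xy: "x \<in> space MX" "y \<in> space MY"
    using assms unfolding space_joint by auto
  have "X.fibre_move MH z = MH (x, y) \<Otimes>\<^sub>M return MY y"
    unfolding z using xy by (intro X_fibre_move_eq prob_space_MH sets_MH)
  then show ?thesis
    unfolding z P_RC_def prod.case Y_gibbs_eq[OF xy] sets_joint sets_eq_imp_space_eq[OF sets_joint] by simp
qed

theorem P_DG_rate_less_one:
  assumes r: "0 < r" "r < 1" and rate: "L2_rate PJ (P_RC MX MY dXY dYX q r) < 1"
  shows "L2_rate PJ (P_DG MX MY dXY dYX) < 1"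
proof -
  let ?R = "P_RC MX MY dXY dYX q r"
  note RC = mixture_kernel_reversible[OF MH_move_reversible Y.gibbs_reversible _ _ P_RC_eq[of _ r]]
  have reversible_R: "reversible_kernel PJ ?R" using r by (intro RC(1)) auto
  then interpret R: reversible_kernel PJ ?R .
  obtain \<rho> where \<rho>: "\<rho> \<in> geometric_rates PJ ?R" "\<rho> < 1"
    using L2_rate_lessD[OF rate] R.one_geometric_rate by blast
  show ?thesis
  proof (rule alternating_rate_less_one[OF markov_kernel_P_DG Y.gibbs_reversible X.gibbs_reversible
        kernel_op_P_DG Y.gibbs_idempotent])
    \<comment> \<open>the contraction factor of the squared norm that the spectral gap provides\<close>
    show "1 - (1 - \<rho>) / (2 * r) < 1" using r \<rho>(2) by simp
    show "(\<integral>z. (kernel_op X.gibbs f z)\<^sup>2 \<partial>PJ) \<le> (1 - (1 - \<rho>) / (2 * r)) * (\<integral>z. (f z)\<^sup>2 \<partial>PJ)"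
      if "f \<in> bdd_fun PJ" "(\<integral>z. f z \<partial>PJ) = 0" "\<And>z. z \<in> space PJ \<Longrightarrow> kernel_op Y.gibbs f z = f z" for f
      using r by (intro alternating_contraction[OF X.gibbs_reversible MH_move_reversible
        reversible_R r(1) RC(2) X.gibbs_idempotent X.fibre_move_fixes_gibbs[OF MH_kernel] \<rho>(1) that]) auto
  qed
qed

end

section \<open>Comparison of the two samplers\<close>

theorem proposition5p4:
  fixes MX :: "'x measure" and MY :: "'y measure" and PJ :: "('x \<times> 'y) measure"
    and dXY :: "'x \<Rightarrow> 'y \<Rightarrow> real" and dYX :: "'y \<Rightarrow> 'x \<Rightarrow> real"
    and q :: "'x \<Rightarrow> 'x \<times> 'y \<Rightarrow> real" and r :: real
  assumes "sigma_finite_measure MX" and "sigma_finite_measure MY"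
    and "prob_space PJ" and "sets PJ = sets (MX \<Otimes>\<^sub>M MY)"
    and "conditional_density MX MY dXY" and "conditional_density MY MX dYX"
    and "is_conditional_X_given_Y MX MY PJ (conditional_dist MX dXY)"
    and "is_conditional_Y_given_X MX MY PJ (conditional_dist MY dYX)"
    and "\<exists>A1 \<in> sets MX. \<exists>A2 \<in> sets MX. A1 \<inter> A2 = {} \<and>
           emeasure (marginal_X MX PJ) A1 > 0 \<and> emeasure (marginal_X MX PJ) A2 > 0"
    and "\<exists>B1 \<in> sets MY. \<exists>B2 \<in> sets MY. B1 \<inter> B2 = {} \<and>
           emeasure (marginal_Y MY PJ) B1 > 0 \<and> emeasure (marginal_Y MY PJ) B2 > 0"
    and "conditional_density MX (MX \<Otimes>\<^sub>M MY) q"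
    and "0 < r" and "r < 1"
    and "L2_rate PJ (P_RC MX MY dXY dYX q r) < 1"
  shows "L2_rate PJ (P_DG MX MY dXY dYX) < 1"
proof -
  interpret metropolis_within_gibbs PJ MX MY dXY dYX q
    by (intro metropolis_within_gibbs.intro bivariate_model.intro bivariate_model_axioms.intro
        metropolis_within_gibbs_axioms.intro assms)
  show ?thesis using assms(12-14) by (rule P_DG_rate_less_one)
qed

end
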